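(* Let $\mathsf{R}$ and $\mathsf{E}$ be totally ordered finite sets with $|\mathsf{R}|=d\le n=|\mathsf{E}|$. Let $(M_\sigma)_{\sigma\in\binom{\mathsf{E}}{d}}$ be a polyhedral matching field (i.e. one extracted from a triangulation of $\triangle_{d-1}\times\triangle_{n-1}$), and let $A\in\{+,-\}^{\mathsf{R}\times\mathsf{E}}$ be a full $d\times n$ sign matrix. Then the sign map $\chi:\binom{\mathsf{E}}{d}\to\{+,-\}$ defined by $$\sigma\longmapsto \operatorname{sign}(M_\sigma)\prod_{e\in M_\sigma}A_e$$ is the chirotope of a uniform oriented matroid of rank $d$ on $\mathsf{E}$.
   Context: Signs $+,-,0$ are identified with $1,-1,0$. **Triangulations and trees.** $\triangle_{k-1}=\operatorname{conv}\{\mathbf e_1,\dots,\mathbf e_k\}\subset\mathbb R^k$. A triangulation of $\triangle_{d-1}\times\triangle_{n-1}$ is a collection of full-dimensional simplices whose vertices are among the vertices $(\mathbf e_i,\mathbf e_j)$ of $\triangle_{d-1}\times\triangle_{n-1}$, whose union is $\triangle_{d-1}\times\triangle_{n-1}$, and any two of which intersect in a common face. Identifying $\mathsf R\cong[d]$, $\mathsf E\cong[n]$ and the vertex $(\mathbf e_i,\mathbf e_j)$ with the edge $(i,j)$ of the complete bipartite graph $K_{\mathsf R,\mathsf E}$ on $\mathsf R\sqcup\mathsf E$, each simplex becomes a spanning tree of $K_{\mathsf R,\mathsf E}$. **Polyhedral matching field.** Given such a triangulation, for every $d$-subset $\sigma\subseteq\mathsf E$ there is exactly one perfect matching $M_\sigma$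 between $\mathsf R$ and $\sigma$ that occurs as a subgraph of at least one of these trees. The family $(M_\sigma)$ is the polyhedral matching field of the triangulation. **Sign of a matching.** $\operatorname{sign}(M_\sigma)$ is the sign of the permutation $[d]\to\mathsf R\to\sigma\to[d]$, where the first and last maps are the order-preserving bijections and the middle one is the bijection given by $M_\sigma$. **Chirotope.** A chirotope on $\mathsf E$ of rank $d$ is a non-zero alternating map $\chi:\mathsf E^d\to\{+,-,0\}$ such that for all $x_1,\dots,x_{d-1},y_1,\dots,y_{d+1}\in\mathsf E$ the $d+1$ expressions $(-1)^k\chi(x_1,\dots,x_{d-1},y_k)\,\chi(y_1,\dots,\widehat{y_k},\dots,y_{d+1})$, $k=1,\dots,d+1$, either contain both a positive and a negative term or are all zero. A map on $\binom{\mathsf E}{d}$ is regarded as an alternating map on $\mathsf E^d$ via $\chi(\sigma)=\chi(\sigma_1,\dots,\sigma_d)$ for $\sigma=\{\sigma_1<\dots<\sigma_d\}$ (and value $0$ on tuples with repeated entries). An oriented matroid is a chirotope up to global sign; it is uniform if $\chi$ is non-zero on every $d$-subset. *)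

theory Defs
  imports "HOL-Analysis.Analysis" "HOL-Combinatorics.Permutations"
begin

section \<open>Triangulations of a product of two simplices\<close>

text \<open>
  The finite totally ordered sets R and E are the universes of two types of sort
  {finite, linorder}, so that d = CARD('r) and n = CARD('e).
\<close>

definition unit_simplex :: "(real ^ 'k::finite) set" where
  "unit_simplex = convex hull (range (\<lambda>i. axis i 1))"

definition prod_vertex :: "'r::finite \<times> 'e::finite \<Rightarrow> (real ^ 'r) \<times> (real ^ 'e)" where
  "prod_vertex = (\<lambda>(i, j). (axis i 1, axis j 1))"

text \<open>
  The library predicate \<^const>\<open>triangulation\<close> says that the collection is finite, consists
  of simplices, and that any two members intersect in a (possibly empty) common face.
  Full dimension means dimension (d - 1) + (n - 1).
\<close>

definition product_triangulation ::
  "((real ^ 'r::finite) \<times> (real ^ 'e::finite)) set set \<Rightarrow> bool" where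
  "product_triangulation \<T> \<longleftrightarrow>
     triangulation \<T> \<and>
     (\<forall>S\<in>\<T>. (int CARD('r) + int CARD('e) - 2) simplex S) \<and>
     (\<forall>S\<in>\<T>. {v. v extreme_point_of S} \<subseteq> range prod_vertex) \<and>
     \<Union>\<T> = unit_simplex \<times> unit_simplex"

definition tree_of :: "((real ^ 'r::finite) \<times> (real ^ 'e::finite)) set \<Rightarrow> ('r \<times> 'e) set" where
  "tree_of S = {e. prod_vertex e extreme_point_of S}"


section \<open>Polyhedral matching fields\<close>

definition perfect_matching :: "'e set \<Rightarrow> ('r \<times> 'e) set \<Rightarrow> bool" where
  "perfect_matching \<sigma> M \<longleftrightarrow>
     M \<subseteq> UNIV \<times> \<sigma> \<and> (\<forall>i. \<exists>!j. (i, j) \<in> M) \<and> (\<forall>j\<in>\<sigma>. \<exists>!i. (i, j) \<in> M)"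

text \<open>
  Only the values on sets of cardinality d matter. For such a set the perfect matching occurring
  in a tree of the triangulation is unique; this is a theorem about triangulations, and it is
  therefore not made part of the definition.
\<close>

definition matching_field_of ::
  "((real ^ 'r::finite) \<times> (real ^ 'e::finite)) set set \<Rightarrow> ('e set \<Rightarrow> ('r \<times> 'e) set) \<Rightarrow> bool" where
  "matching_field_of \<T> M \<longleftrightarrow>
     (\<forall>\<sigma>. card \<sigma> = CARD('r) \<longrightarrow>
        perfect_matching \<sigma> (M \<sigma>) \<and> (\<exists>S\<in>\<T>. M \<sigma> \<subseteq> tree_of S))"

definition polyhedral_matching_field :: "('e::finite set \<Rightarrow> ('r::finite \<times> 'e) set) \<Rightarrow> bool" where
  "polyhedral_matching_field M \<longleftrightarrow> (\<exists>\<T>. product_triangulation \<T> \<and> matching_field_of \<T> M)"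


section \<open>Signs\<close>

text \<open>
  The order-preserving bijection from {0, ..., card S - 1} to S, and its inverse. The set [d] is
  modelled by {0, ..., d - 1}.
\<close>

definition order_enum :: "'a::linorder set \<Rightarrow> nat \<Rightarrow> 'a" where
  "order_enum S k = sorted_list_of_set S ! k"

definition order_index :: "'a::linorder set \<Rightarrow> 'a \<Rightarrow> nat" where
  "order_index S = inv_into {..<card S} (order_enum S)"

definition partner :: "('r \<times> 'e) set \<Rightarrow> 'r \<Rightarrow> 'e" where
  "partner M i = (THE j. (i, j) \<in> M)"

definition matching_sign :: "'e::linorder set \<Rightarrow> ('r::{finite,linorder} \<times> 'e) set \<Rightarrow> int" where
  "matching_sign \<sigma> M =
     sign_on {..<CARD('r)} (order_index \<sigma> \<circ> partner M \<circ> order_enum (UNIV :: 'r set))"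


section \<open>Chirotopes\<close>

text \<open>
  Elements of E^d are lists of length d; values on lists of other lengths are irrelevant.
  The signs +, -, 0 are the integers 1, -1, 0.
\<close>

definition alternating :: "nat \<Rightarrow> ('e list \<Rightarrow> int) \<Rightarrow> bool" where
  "alternating d c \<longleftrightarrow>
     (\<forall>xs. length xs = d \<longrightarrow>
        (\<not> distinct xs \<longrightarrow> c xs = 0) \<and>
        (\<forall>p. p permutes {..<d} \<longrightarrow> c (permute_list p xs) = sign p * c xs))"

text \<open>
  The k-th of the d + 1 expressions, k being counted from 0 here (hence the exponent k + 1).
\<close>

definition exchange_term :: "('e list \<Rightarrow> int) \<Rightarrow> 'e list \<Rightarrow> 'e list \<Rightarrow> nat \<Rightarrow> int" where
  "exchange_term c xs ys k =
     (-1) ^ (k + 1) * c (xs @ [ys ! k]) * c (take k ys @ drop (Suc k) ys)"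

definition chirotope :: "nat \<Rightarrow> ('e list \<Rightarrow> int) \<Rightarrow> bool" where
  "chirotope d c \<longleftrightarrow>
     (\<forall>xs. length xs = d \<longrightarrow> c xs \<in> {1, -1, 0}) \<and>
     (\<exists>xs. length xs = d \<and> c xs \<noteq> 0) \<and>
     alternating d c \<and>
     (\<forall>xs ys. length xs + 1 = d \<and> length ys = d + 1 \<longrightarrow>
        (\<exists>k\<le>d. exchange_term c xs ys k > 0) \<and> (\<exists>k\<le>d. exchange_term c xs ys k < 0) \<or>
        (\<forall>k\<le>d. exchange_term c xs ys k = 0))"

text \<open>
  The alternating map determined by a map on subsets: a tuple with distinct entries gets the
  value on its underlying set times the sign of the permutation relating it to the increasing
  tuple.
\<close>

definition alternating_extension :: "('e::linorder set \<Rightarrow> int) \<Rightarrow> 'e list \<Rightarrow> int" where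
  "alternating_extension f xs =
     (if distinct xs
      then sign_on {..<length xs} (\<lambda>k. order_index (set xs) (xs ! k)) * f (set xs)
      else 0)"

text \<open>
  The map f on d-subsets is the chirotope of a uniform oriented matroid of rank d on the
  universe of the type.
\<close>

definition uniform_oriented_matroid_chirotope :: "nat \<Rightarrow> ('e::linorder set \<Rightarrow> int) \<Rightarrow> bool" where
  "uniform_oriented_matroid_chirotope d f \<longleftrightarrow>
     chirotope d (alternating_extension f) \<and> (\<forall>\<sigma>. finite \<sigma> \<and> card \<sigma> = d \<longrightarrow> f \<sigma> \<noteq> 0)"

end

theory Submission
  imports Defs
begin

text \<open>
  A triangulation enters only through two properties of the trees of its simplices, viewed as
  supports of nonnegative flows on the complete bipartite graph: every pair of marginals of equal
  mass is realised by a flow on some tree, and two flows with the same marginals, each supported on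
  some tree, coincide. Choosing marginals suitably and applying Hall's theorem, one finds for every
  \<open>(d - 1)\<close>-tuple \<open>xs\<close> a tree containing all matchings of \<open>xs\<close> extended by one element, and for every
  \<open>(d + 1)\<close>-tuple \<open>ys\<close> a tree containing all matchings of \<open>ys\<close> with one element removed. The first
  expresses the cocircuit \<open>j \<mapsto> \<chi>(xs, j)\<close> as \<open>\<mu> i * A i j\<close> along its edges, the second shows that the
  signed circuit of \<open>ys\<close> is orthogonal to every row of \<open>A\<close> on the edges at that row. If the two
  sign vectors were not orthogonal, alternating between the two trees would produce a closed walk, and
  hence two different flows with the same marginals.
\<close>

section \<open>Flows on the trees of a triangulation\<close>

lemma affine_independent_combination_unique:
  fixes C :: "'a::euclidean_space set"
  assumes "\<not> affine_dependent C" "sum u C = sum w C"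
    and "(\<Sum>v\<in>C. u v *\<^sub>R v) = (\<Sum>v\<in>C. w v *\<^sub>R v)" "v \<in> C"
  shows "u v = w v"
proof -
  have "finite C"
    using assms(1) by (rule aff_independent_finite)
  moreover have "sum (\<lambda>v. u v - w v) C = 0" "(\<Sum>v\<in>C. (u v - w v) *\<^sub>R v) = 0"
    using assms(2,3) by (simp_all add: sum_subtractf scaleR_left_diff_distrib)
  ultimately show ?thesis
    using assms(1,4) unfolding affine_dependent_explicit_finite[OF \<open>finite C\<close>] by force
qed

text \<open>A common face is the hull of a subset of the vertices of either simplex, and both
  subsets consist of its extreme points, so they agree. The common point has coordinates over these
  shared vertices; extended by zero, they must coincide with \<open>a\<close> and with
  \<open>b\<close> by affine independence.\<close>

lemma convex_combination_unique_common_face: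
  fixes C C' :: "'a::euclidean_space set"
  assumes indep: "\<not> affine_dependent C" "\<not> affine_dependent C'"
    and face: "convex hull C \<inter> convex hull C' face_of convex hull C"
      "convex hull C \<inter> convex hull C' face_of convex hull C'"
    and nonneg: "\<And>v. 0 \<le> a v" "\<And>v. 0 \<le> b v"
    and supp: "\<And>v. v \<notin> C \<Longrightarrow> a v = 0" "\<And>v. v \<notin> C' \<Longrightarrow> b v = 0"
    and total: "sum a C = 1" "sum b C' = 1"
    and eq: "(\<Sum>v\<in>C. a v *\<^sub>R v) = (\<Sum>v\<in>C'. b v *\<^sub>R v)"
  shows "a = b"
proof -
  define F where "F = convex hull C \<inter> convex hull C'"
  obtain c where c: "c \<subseteq> C" "F = convex hull c"
    using face(1) face_of_convex_hull_affine_independent[OF indep(1)] F_def by blast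
  obtain c' where c': "c' \<subseteq> C'" "F = convex hull c'"
    using face(2) face_of_convex_hull_affine_independent[OF indep(2)] F_def by blast
  have "\<not> affine_dependent c" "\<not> affine_dependent c'"
    using affine_dependent_subset c(1) c'(1) indep by blast+
  then have "c = c'"
    using extreme_point_of_convex_hull_affine_independent c(2) c'(2) by (metis subsetI subset_antisym)
  have fin: "finite C" "finite C'" "finite c"
    using indep aff_independent_finite c(1) finite_subset by blast+
  define p where "p = (\<Sum>v\<in>C. a v *\<^sub>R v)"
  have "p \<in> convex hull C"
    unfolding convex_hull_finite[OF fin(1)] using nonneg(1) total(1) p_def by (intro CollectI exI[of _ a]) simp
  moreover have "p \<in> convex hull C'"
    unfolding convex_hull_finite[OF fin(2)] using nonneg(2) total(2) p_def eq by (intro CollectI exI[of _ b]) simp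
  ultimately have "p \<in> convex hull c"
    using F_def c(2) by blast
  then obtain w where w: "sum w c = 1" "(\<Sum>v\<in>c. w v *\<^sub>R v) = p"
    unfolding convex_hull_finite[OF fin(3)] by blast
  define u where "u v = (if v \<in> c then w v else 0)" for v
  have u: "sum u B = 1" "(\<Sum>v\<in>B. u v *\<^sub>R v) = p" if "c \<subseteq> B" "finite B" for B
  proof -
    have "sum u B = sum w c"
      unfolding u_def using that by (simp add: sum.If_cases Int_absorb1)
    then show "sum u B = 1"
      using w(1) by simp
    have "(\<Sum>v\<in>B. u v *\<^sub>R v) = (\<Sum>v\<in>c. u v *\<^sub>R v)"
      by (rule sum.mono_neutral_right) (use that u_def in auto)
    then show "(\<Sum>v\<in>B. u v *\<^sub>R v) = p"
      using w(2) by (simp add: u_def)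
  qed
  have "a v = u v" for v
  proof (cases "v \<in> C")
    case True
    then show ?thesis
      using affine_independent_combination_unique[OF indep(1), of a u v] u[OF c(1) fin(1)] total(1) p_def
      by simp
  qed (use supp(1) c(1) u_def in auto)
  moreover have "b v = u v" for v
  proof (cases "v \<in> C'")
    case True
    then show ?thesis
      using affine_independent_combination_unique[OF indep(2), of b u v] u[of C'] c'(1) \<open>c = c'\<close> fin(2)
        total(2) p_def eq by simp
  qed (use supp(2) c'(1) \<open>c = c'\<close> u_def in auto)
  ultimately show ?thesis
    by (simp add: fun_eq_iff)
qed

section \<open>Points of the product of simplices as marginals of flows\<close>

lemma inj_prod_vertex: "inj prod_vertex"
  by (auto simp: inj_on_def prod_vertex_def axis_eq_axis)

text \<open>Links geometry to flows: the weights of a combination of product vertices form a flow,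
  and the point they represent is the pair of its marginals.\<close>

lemma sum_scaleR_prod_vertex:
  fixes a :: "'r::finite \<Rightarrow> 'e::finite \<Rightarrow> real"
  shows "(\<Sum>(i, j)\<in>UNIV. a i j *\<^sub>R prod_vertex (i, j)) = (\<chi> i. \<Sum>j\<in>UNIV. a i j, \<chi> j. \<Sum>i\<in>UNIV. a i j)"
proof (rule prod_eqI)
  have "(\<Sum>(i, j)\<in>UNIV. a i j *\<^sub>R axis i (1::real)) $ k = (\<Sum>j\<in>UNIV. a k j)" for k
  proof -
    have "(\<Sum>(i, j)\<in>UNIV. a i j *\<^sub>R axis i (1::real)) $ k = (\<Sum>(i, j)\<in>UNIV. if i = k then a i j else 0)"
      by (auto simp: sum_component axis_def intro!: sum.cong)
    also have "\<dots> = (\<Sum>i\<in>UNIV. if i = k then \<Sum>j\<in>UNIV. a i j else 0)"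
      by (auto simp: UNIV_Times_UNIV[symmetric] sum.cartesian_product[symmetric] simp del: UNIV_Times_UNIV sum.delta sum.delta' intro!: sum.cong)
    finally show ?thesis by simp
  qed
  then show "fst (\<Sum>(i, j)\<in>UNIV. a i j *\<^sub>R prod_vertex (i, j)) = fst (\<chi> i. \<Sum>j\<in>UNIV. a i j, \<chi> j. \<Sum>i\<in>UNIV. a i j)"
    by (simp add: vec_eq_iff fst_sum case_prod_unfold prod_vertex_def)
  have "(\<Sum>(i, j)\<in>UNIV. a i j *\<^sub>R axis j (1::real)) $ k = (\<Sum>i\<in>UNIV. a i k)" for k
  proof -
    have "(\<Sum>(i, j)\<in>UNIV. a i j *\<^sub>R axis j (1::real)) $ k = (\<Sum>(i, j)\<in>UNIV. if j = k then a i j else 0)"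
      by (auto simp: sum_component axis_def intro!: sum.cong)
    also have "\<dots> = (\<Sum>i\<in>UNIV. a i k)"
      by (simp add: UNIV_Times_UNIV[symmetric] sum.cartesian_product[symmetric] del: UNIV_Times_UNIV)
    finally show ?thesis .
  qed
  then show "snd (\<Sum>(i, j)\<in>UNIV. a i j *\<^sub>R prod_vertex (i, j)) = snd (\<chi> i. \<Sum>j\<in>UNIV. a i j, \<chi> j. \<Sum>i\<in>UNIV. a i j)"
    by (simp add: vec_eq_iff snd_sum case_prod_unfold prod_vertex_def)
qed

lemma nonneg_sum_one_in_unit_simplex:
  assumes "\<And>i. 0 \<le> x i" "(\<Sum>i\<in>UNIV. x i) = 1"
  shows "(\<chi> i. x i) \<in> unit_simplex"
proof -
  have "(\<Sum>i\<in>UNIV. x i *\<^sub>R axis i (1::real)) \<in> unit_simplex"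
    unfolding unit_simplex_def using assms
    by (intro convex_sum) (auto intro: hull_inc)
  moreover have "(\<Sum>i\<in>UNIV. x i *\<^sub>R axis i (1::real)) = (\<chi> i. x i)"
    by (simp add: vec_eq_iff sum_component axis_def if_distrib cong: if_cong)
  ultimately show ?thesis
    by simp
qed

text \<open>\<open>flow_unique\<close> encodes that two simplices meet in a common face,
  \<open>flow_exists\<close> that the simplices cover the product. Uniqueness is stated for flows of
  any total mass, so that it applies directly to flows counting edges.\<close>

locale tree_family =
  fixes \<G> :: "('r::finite \<times> 'e::finite) set set"
  assumes flow_unique:
    "\<lbrakk>T \<in> \<G>; T' \<in> \<G>; \<And>i j. 0 \<le> a i j; \<And>i j. 0 \<le> b i j;
      \<And>i j. (i, j) \<notin> T \<Longrightarrow> a i j = 0; \<And>i j. (i, j) \<notin> T' \<Longrightarrow> b i j = 0;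
      \<And>i. (\<Sum>j\<in>UNIV. a i j) = (\<Sum>j\<in>UNIV. b i j); \<And>j. (\<Sum>i\<in>UNIV. a i j) = (\<Sum>i\<in>UNIV. b i j)\<rbrakk>
     \<Longrightarrow> a = (b :: 'r \<Rightarrow> 'e \<Rightarrow> real)"
    and flow_exists:
    "\<lbrakk>\<And>i. 0 \<le> x i; \<And>j. 0 \<le> y j; (\<Sum>i\<in>UNIV. x i) = 1; (\<Sum>j\<in>UNIV. y j) = 1\<rbrakk>
     \<Longrightarrow> \<exists>T\<in>\<G>. \<exists>a :: 'r \<Rightarrow> 'e \<Rightarrow> real. (\<forall>i j. 0 \<le> a i j) \<and> (\<forall>i j. (i, j) \<notin> T \<longrightarrow> a i j = 0) \<and>
           (\<forall>i. (\<Sum>j\<in>UNIV. a i j) = x i) \<and> (\<forall>j. (\<Sum>i\<in>UNIV. a i j) = y j)"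

lemma product_triangulation_simplexE:
  assumes "product_triangulation \<T>" "S \<in> \<T>"
  obtains C where "\<not> affine_dependent C" "S = convex hull C" "C = prod_vertex ` tree_of S"
proof -
  obtain C where C: "\<not> affine_dependent C" "S = convex hull C"
    using assms unfolding product_triangulation_def simplex_def by blast
  have "C = {v. v extreme_point_of S}"
    using extreme_point_of_convex_hull_affine_independent[OF C(1)] C(2) by auto
  moreover have "{v. v extreme_point_of S} \<subseteq> range prod_vertex"
    using assms unfolding product_triangulation_def by blast
  ultimately have "C = prod_vertex ` tree_of S"
    unfolding tree_of_def by blast
  with C that show thesis
    by blast
qed

lemma sum_prod_vertex_image:
  fixes a :: "'r::finite \<Rightarrow> 'e::finite \<Rightarrow> real"
  assumes "\<And>i j. (i, j) \<notin> T \<Longrightarrow> a i j = 0"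
  defines "u \<equiv> \<lambda>v. case_prod a (inv prod_vertex v)"
  shows "(\<Sum>v\<in>prod_vertex ` T. u v) = (\<Sum>i\<in>UNIV. \<Sum>j\<in>UNIV. a i j)"
    and "(\<Sum>v\<in>prod_vertex ` T. u v *\<^sub>R v) = (\<chi> i. \<Sum>j\<in>UNIV. a i j, \<chi> j. \<Sum>i\<in>UNIV. a i j)"
proof -
  have inj: "inj_on prod_vertex T"
    by (rule inj_on_subset[OF inj_prod_vertex]) simp
  have u: "u (prod_vertex e) = case_prod a e" for e
    by (simp add: u_def inj_prod_vertex)
  have "(\<Sum>v\<in>prod_vertex ` T. u v) = (\<Sum>e\<in>T. case_prod a e)"
    by (simp add: sum.reindex[OF inj] u)
  also have "\<dots> = (\<Sum>e\<in>UNIV. case_prod a e)"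
    by (rule sum.mono_neutral_left) (use assms(1) in auto)
  finally show "(\<Sum>v\<in>prod_vertex ` T. u v) = (\<Sum>i\<in>UNIV. \<Sum>j\<in>UNIV. a i j)"
    by (simp add: sum.cartesian_product)
  have "(\<Sum>v\<in>prod_vertex ` T. u v *\<^sub>R v) = (\<Sum>e\<in>T. case_prod a e *\<^sub>R prod_vertex e)"
    by (simp add: sum.reindex[OF inj] u)
  also have "\<dots> = (\<Sum>e\<in>UNIV. case_prod a e *\<^sub>R prod_vertex e)"
    by (rule sum.mono_neutral_left) (use assms(1) in auto)
  also have "\<dots> = (\<chi> i. \<Sum>j\<in>UNIV. a i j, \<chi> j. \<Sum>i\<in>UNIV. a i j)"
    using sum_scaleR_prod_vertex[of a] by (simp add: case_prod_unfold)
  finally show "(\<Sum>v\<in>prod_vertex ` T. u v *\<^sub>R v) = (\<chi> i. \<Sum>j\<in>UNIV. a i j, \<chi> j. \<Sum>i\<in>UNIV. a i j)" .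
qed

theorem product_triangulation_tree_family:
  fixes \<T> :: "((real ^ 'r::finite) \<times> (real ^ 'e::finite)) set set"
  assumes tri: "product_triangulation \<T>"
  shows "tree_family (tree_of ` \<T>)"
proof
  fix T T' :: "('r \<times> 'e) set" and a b :: "'r \<Rightarrow> 'e \<Rightarrow> real"
  assume T: "T \<in> tree_of ` \<T>" "T' \<in> tree_of ` \<T>"
    and nonneg: "\<And>i j. 0 \<le> a i j" "\<And>i j. 0 \<le> b i j"
    and supp: "\<And>i j. (i, j) \<notin> T \<Longrightarrow> a i j = 0" "\<And>i j. (i, j) \<notin> T' \<Longrightarrow> b i j = 0"
    and marg: "\<And>i. (\<Sum>j\<in>UNIV. a i j) = (\<Sum>j\<in>UNIV. b i j)" "\<And>j. (\<Sum>i\<in>UNIV. a i j) = (\<Sum>i\<in>UNIV. b i j)"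
  obtain S S' where S: "S \<in> \<T>" "S' \<in> \<T>" "T = tree_of S" "T' = tree_of S'"
    using T by blast
  obtain C where C: "\<not> affine_dependent C" "S = convex hull C" "C = prod_vertex ` T"
    using product_triangulation_simplexE[OF tri S(1)] unfolding S(3) .
  obtain C' where C': "\<not> affine_dependent C'" "S' = convex hull C'" "C' = prod_vertex ` T'"
    using product_triangulation_simplexE[OF tri S(2)] unfolding S(4) .
  have "X \<inter> Y face_of X" if "X \<in> \<T>" "Y \<in> \<T>" for X Y
    using tri that by (simp add: product_triangulation_def triangulation_def)
  from this[of S S'] this[of S' S] have face: "S \<inter> S' face_of S" "S \<inter> S' face_of S'"
    using S(1,2) by (simp_all add: Int_commute)
  define s where "s = (\<Sum>i\<in>UNIV. \<Sum>j\<in>UNIV. a i j)"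
  have sb: "s = (\<Sum>i\<in>UNIV. \<Sum>j\<in>UNIV. b i j)"
    unfolding s_def using marg(1) by simp
  show "a = b"
  proof (cases "s = 0")
    case True
    have "a i j = 0" for i j
      using True nonneg(1) unfolding s_def by (simp add: sum_nonneg_eq_0_iff sum_nonneg)
    moreover have "b i j = 0" for i j
      using True nonneg(2) unfolding sb by (simp add: sum_nonneg_eq_0_iff sum_nonneg)
    ultimately show ?thesis
      by (simp add: fun_eq_iff)
  next
    \<comment> \<open>After division by the common mass \<open>s\<close>, both flows become
      barycentric coordinates of the same point, one in each simplex.\<close>
    case False
    then have "s > 0"
      using nonneg(1) unfolding s_def by (simp add: order_less_le sum_nonneg)
    define u where "u v = case_prod (\<lambda>i j. a i j / s) (inv prod_vertex v)" for v
    define w where "w v = case_prod (\<lambda>i j. b i j / s) (inv prod_vertex v)" for v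
    have supp': "(i, j) \<notin> T \<Longrightarrow> a i j / s = 0" "(i, j) \<notin> T' \<Longrightarrow> b i j / s = 0" for i j
      using supp by auto
    note sums = sum_prod_vertex_image[of T "\<lambda>i j. a i j / s", OF supp'(1), folded u_def C(3)]
      sum_prod_vertex_image[of T' "\<lambda>i j. b i j / s", OF supp'(2), folded w_def C'(3)]
    have inv: "inv prod_vertex (prod_vertex e) = e" for e :: "'r \<times> 'e"
      by (simp add: inj_prod_vertex)
    have nonneg': "0 \<le> u v" "0 \<le> w v" for v
      unfolding u_def w_def using nonneg \<open>s > 0\<close> by (auto split: prod.split)
    \<comment> \<open>Off the range of \<open>prod_vertex\<close> the value of
      \<open>inv prod_vertex\<close> is arbitrary, so the weights are cut off explicitly outside the
      vertices of each simplex.\<close>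
    define u' where "u' v = (if v \<in> C then u v else 0)" for v
    define w' where "w' v = (if v \<in> C' then w v else 0)" for v
    have "u' = w'"
    proof (rule convex_combination_unique_common_face)
      show "\<not> affine_dependent C" "\<not> affine_dependent C'" by fact+
      show "convex hull C \<inter> convex hull C' face_of convex hull C"
        "convex hull C \<inter> convex hull C' face_of convex hull C'"
        using face C(2) C'(2) by auto
      show "0 \<le> u' v" "0 \<le> w' v" "v \<notin> C \<Longrightarrow> u' v = 0" "v \<notin> C' \<Longrightarrow> w' v = 0" for v
        using nonneg' by (auto simp: u'_def w'_def)
      show "sum u' C = 1" "sum w' C' = 1"
        using sums(1,3) \<open>s > 0\<close>
        by (simp_all add: u'_def w'_def sum_divide_distrib[symmetric] s_def[symmetric] sb[symmetric])
      show "(\<Sum>v\<in>C. u' v *\<^sub>R v) = (\<Sum>v\<in>C'. w' v *\<^sub>R v)"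
        using sums(2,4) by (simp add: u'_def w'_def sum_divide_distrib[symmetric] marg)
    qed
    moreover have "u' (prod_vertex (i, j)) = a i j / s" "w' (prod_vertex (i, j)) = b i j / s" for i j
      using supp
      by (auto simp: u'_def w'_def u_def w_def inv C(3) C'(3) inj_image_mem_iff[OF inj_prod_vertex])
    ultimately have "a i j / s = b i j / s" for i j
      by metis
    then show ?thesis
      using \<open>s > 0\<close> by (simp add: fun_eq_iff)
  qed
next
  fix x :: "'r \<Rightarrow> real" and y :: "'e \<Rightarrow> real"
  assume xy: "\<And>i. 0 \<le> x i" "\<And>j. 0 \<le> y j" "(\<Sum>i\<in>UNIV. x i) = 1" "(\<Sum>j\<in>UNIV. y j) = 1"
  have "(\<chi> i. x i, \<chi> j. y j) \<in> unit_simplex \<times> unit_simplex"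
    using xy by (simp add: nonneg_sum_one_in_unit_simplex)
  also have "\<dots> = \<Union>\<T>"
    using tri by (simp add: product_triangulation_def)
  finally obtain S where S: "S \<in> \<T>" "(\<chi> i. x i, \<chi> j. y j) \<in> S"
    by blast
  obtain C where C: "\<not> affine_dependent C" "S = convex hull C" "C = prod_vertex ` tree_of S"
    using product_triangulation_simplexE[OF tri S(1)] .
  obtain u where u: "\<And>v. v \<in> C \<Longrightarrow> 0 \<le> u v" "(\<Sum>v\<in>C. u v *\<^sub>R v) = (\<chi> i. x i, \<chi> j. y j)"
    using S(2) unfolding C(2) convex_hull_finite[OF aff_independent_finite[OF C(1)]] by blast
  define a where "a i j = (if (i, j) \<in> tree_of S then u (prod_vertex (i, j)) else 0)" for i j
  have supp: "(i, j) \<notin> tree_of S \<Longrightarrow> a i j = 0" for i j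
    by (simp add: a_def)
  have "(\<Sum>v\<in>C. u v *\<^sub>R v) = (\<Sum>v\<in>C. case_prod a (inv prod_vertex v) *\<^sub>R v)"
    by (rule sum.cong) (auto simp: C(3) a_def inj_prod_vertex)
  also have "\<dots> = (\<chi> i. \<Sum>j\<in>UNIV. a i j, \<chi> j. \<Sum>i\<in>UNIV. a i j)"
    using sum_prod_vertex_image(2)[of "tree_of S" a] supp C(3) by simp
  finally have "(\<Sum>j\<in>UNIV. a i j) = x i" "(\<Sum>i\<in>UNIV. a i j) = y j" for i j
    using u(2) by (auto simp: vec_eq_iff)
  moreover have "0 \<le> a i j" for i j
    using u(1) C(3) by (simp add: a_def)
  ultimately show "\<exists>T\<in>tree_of ` \<T>. \<exists>a. (\<forall>i j. 0 \<le> a i j) \<and> (\<forall>i j. (i, j) \<notin> T \<longrightarrow> a i j = 0) \<and>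
           (\<forall>i. (\<Sum>j\<in>UNIV. a i j) = x i) \<and> (\<forall>j. (\<Sum>i\<in>UNIV. a i j) = y j)"
    using S(1) supp by (intro bexI[of _ "tree_of S"] exI[of _ a]) auto
qed

section \<open>Matchings from flows\<close>

text \<open>Induction on the size of \<open>X\<close>. If some nonempty proper subset
  \<open>I\<close> has exactly \<open>card I\<close> neighbours, match \<open>I\<close> among them
  and the rest outside them. Otherwise every nonempty proper subset has a neighbour to spare, so one
  element may be matched arbitrarily and its partner removed.\<close>

lemma Hall_matching:
  fixes N :: "'a \<Rightarrow> 'b set"
  assumes "finite X" "\<And>x. x \<in> X \<Longrightarrow> finite (N x)"
    and "\<And>I. I \<subseteq> X \<Longrightarrow> card I \<le> card (\<Union>(N ` I))"
  shows "\<exists>m. inj_on m X \<and> (\<forall>x\<in>X. m x \<in> N x)"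
  using assms
proof (induction "card X" arbitrary: X N rule: less_induct)
  case less
  have fin: "finite I" "finite (\<Union>(N ` I))" if "I \<subseteq> X" for I
    using finite_subset[OF that less.prems(1)] less.prems(2) that by auto
  show ?case
  proof (cases "\<exists>I. I \<subset> X \<and> I \<noteq> {} \<and> card (\<Union>(N ` I)) = card I")
    case True
    then obtain I where I: "I \<subset> X" "I \<noteq> {}" "card (\<Union>(N ` I)) = card I"
      by blast
    have "card I < card X"
      by (rule psubset_card_mono[OF less.prems(1) I(1)])
    moreover have "\<And>x. x \<in> I \<Longrightarrow> finite (N x)" "\<And>J. J \<subseteq> I \<Longrightarrow> card J \<le> card (\<Union>(N ` J))"
      using I(1) less.prems(2,3) by auto
    ultimately obtain m where m: "inj_on m I" "\<forall>x\<in>I. m x \<in> N x"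
      using less.hyps[of I N] fin(1)[of I] I(1) by auto
    define N' where "N' x = N x - \<Union>(N ` I)" for x
    \<comment> \<open>Hall's condition for \<open>J \<union> I\<close>, minus the exactly
      \<open>card I\<close> neighbours of \<open>I\<close>, gives the condition for \<open>J\<close>
      in the remaining graph.\<close>
    have "card J \<le> card (\<Union>(N' ` J))" if J: "J \<subseteq> X - I" for J
    proof -
      have sub: "J \<union> I \<subseteq> X" "I \<subseteq> X" "J \<subseteq> X"
        using J I(1) by auto
      have "card J + card I = card (J \<union> I)"
        using J sub fin(1) by (subst card_Un_disjoint) auto
      also have "\<dots> \<le> card (\<Union>(N ` (J \<union> I)))"
        using less.prems(3) sub(1) .
      also have "\<Union>(N ` (J \<union> I)) = \<Union>(N' ` J) \<union> \<Union>(N ` I)"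
        by (auto simp: N'_def)
      also have "card \<dots> \<le> card (\<Union>(N' ` J)) + card I"
        using card_Un_le[of "\<Union>(N' ` J)" "\<Union>(N ` I)"] I(3) by simp
      finally show ?thesis
        by simp
    qed
    moreover have "card (X - I) < card X"
      using I less.prems(1) by (intro psubset_card_mono) auto
    moreover have "finite (N' x)" if "x \<in> X - I" for x
      using less.prems(2) that by (simp add: N'_def)
    ultimately obtain m' where m': "inj_on m' (X - I)" "\<forall>x\<in>X - I. m' x \<in> N' x"
      using less.hyps[of "X - I" N'] less.prems(1) by auto
    define f where "f x = (if x \<in> I then m x else m' x)" for x
    have "f x \<noteq> f y" if "x \<in> I" "y \<in> X - I" for x y
      using that m(2) m'(2) unfolding f_def N'_def by auto
    then have "inj_on f X"
      using m(1) m'(1) unfolding inj_on_def by (metis DiffI f_def)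
    moreover have "\<forall>x\<in>X. f x \<in> N x"
      using m(2) m'(2) by (auto simp: f_def N'_def)
    ultimately show ?thesis
      by blast
  next
    case False
    show ?thesis
    proof (cases "X = {}")
      case False
      then obtain x where x: "x \<in> X"
        by blast
      have "N x \<noteq> {}"
        using less.prems(3)[of "{x}"] x by auto
      then obtain y where y: "y \<in> N x"
        by blast
      define N' where "N' z = N z - {y}" for z
      have "card J \<le> card (\<Union>(N' ` J))" if J: "J \<subseteq> X - {x}" for J
      proof (cases "J = {}")
        case False
        have "J \<subset> X"
          using J x by blast
        then have "card J < card (\<Union>(N ` J))"
          using less.prems(3)[of J] False \<open>\<not> (\<exists>I. I \<subset> X \<and> I \<noteq> {} \<and> card (\<Union>(N ` I)) = card I)\<close>
          by (metis order_less_le psubset_imp_subset)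
        moreover have "\<Union>(N' ` J) = \<Union>(N ` J) - {y}"
          by (auto simp: N'_def)
        ultimately show ?thesis
          by (auto simp: card_Diff_singleton_if)
      qed simp
      moreover have "card (X - {x}) < card X"
        using x less.prems(1) by (meson card_Diff1_less)
      moreover have "finite (N' z)" if "z \<in> X - {x}" for z
        using less.prems(2) that by (simp add: N'_def)
      ultimately obtain m where m: "inj_on m (X - {x})" "\<forall>z\<in>X - {x}. m z \<in> N' z"
        using less.hyps[of "X - {x}" N'] less.prems(1) by auto
      have "inj_on (m(x := y)) X"
        using m unfolding inj_on_def N'_def by auto
      moreover have "\<forall>z\<in>X. (m(x := y)) z \<in> N z"
        using m(2) y by (auto simp: N'_def)
      ultimately show ?thesis
        by blast
    qed simp
  qed
qed

text \<open>A nonempty set \<open>I\<close> of rows sends out at least \<open>c * card I\<close>,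
  while each column absorbs at most \<open>c' < c\<close>. So the support meets more than
  \<open>card I\<close> columns, and Hall's condition survives the removal of the single column
  \<open>j0\<close>.\<close>

lemma surplus_flow_matching:
  fixes a :: "'a::finite \<Rightarrow> 'b::finite \<Rightarrow> real"
  assumes nonneg: "\<And>i j. 0 \<le> a i j"
    and row: "\<And>i. i \<in> X \<Longrightarrow> c \<le> (\<Sum>j\<in>UNIV. a i j)"
    and col: "\<And>j. (\<Sum>i\<in>UNIV. a i j) \<le> c'"
    and "c' < c" "0 < c"
  shows "\<exists>m. inj_on m X \<and> (\<forall>i\<in>X. m i \<noteq> j0 \<and> 0 < a i (m i))"
proof -
  define N where "N i = {j. j \<noteq> j0 \<and> 0 < a i j}" for i
  have "card I \<le> card (\<Union>(N ` I))" if I: "I \<subseteq> X" for I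
  proof (cases "I = {}")
    case False
    define Y where "Y = insert j0 (\<Union>(N ` I))"
    have "real (card I) * c \<le> (\<Sum>i\<in>I. \<Sum>j\<in>UNIV. a i j)"
      using row I by (intro sum_bounded_below) auto
    also have "\<dots> = (\<Sum>i\<in>I. \<Sum>j\<in>Y. a i j)"
    proof (rule sum.cong[OF refl])
      fix i assume "i \<in> I"
      then have "a i j = 0" if "j \<notin> Y" for j
        using nonneg[of i j] that by (auto simp: Y_def N_def)
      then show "(\<Sum>j\<in>UNIV. a i j) = (\<Sum>j\<in>Y. a i j)"
        by (intro sum.mono_neutral_right) auto
    qed
    also have "\<dots> = (\<Sum>j\<in>Y. \<Sum>i\<in>I. a i j)"
      by (rule sum.swap)
    also have "\<dots> \<le> (\<Sum>j\<in>Y. c')"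
      using col nonneg by (intro sum_mono order.trans[OF sum_mono2 col]) auto
    also have "\<dots> = real (card Y) * c'"
      by simp
    finally have *: "real (card I) * c \<le> real (card Y) * c'" .
    have "0 < card I"
      using False by (simp add: card_gt_0_iff)
    have "real (card I) * c' < real (card I) * c"
      using \<open>0 < card I\<close> \<open>c' < c\<close> by simp
    with * have lt: "real (card I) * c' < real (card Y) * c'"
      by simp
    \<comment> \<open>The sign of \<open>c'\<close> is what permits cancelling it from the strict
      inequality.\<close>
    have "0 \<le> c'"
      using order.trans[OF sum_nonneg col[of j0]] nonneg by simp
    with lt have "card I < card Y"
      by (simp add: mult_less_cancel_right)
    also have "card Y \<le> Suc (card (\<Union>(N ` I)))"
      unfolding Y_def by (rule card_insert_le_m1) auto
    finally show ?thesis
      by simp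
  qed simp
  then obtain m where "inj_on m X" "\<forall>i\<in>X. m i \<in> N i"
    using Hall_matching[of X N] by auto
  then show ?thesis
    unfolding N_def by blast
qed

text \<open>Take a nonempty subset of least size that \<open>f\<close> maps into itself. Its image
  is again such a subset, hence not smaller, so \<open>f\<close> permutes it. This extracts closed
  walks from a walk that can always be continued.\<close>

lemma exists_invariant_subset:
  assumes "finite X" "X \<noteq> {}" "f ` X \<subseteq> X"
  shows "\<exists>J. J \<subseteq> X \<and> J \<noteq> {} \<and> bij_betw f J J"
proof -
  define P where "P J \<longleftrightarrow> J \<subseteq> X \<and> J \<noteq> {} \<and> f ` J \<subseteq> J" for J
  have "P X"
    using assms by (simp add: P_def)
  then obtain J where J: "P J" "\<And>J'. P J' \<Longrightarrow> card J \<le> card J'"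
    using arg_min_nat_lemma[of P X card] by blast
  have "finite J"
    using J(1) assms(1) by (auto simp: P_def intro: finite_subset)
  have "P (f ` J)"
    using J(1) by (auto simp: P_def)
  then have "card J \<le> card (f ` J)"
    by (rule J(2))
  then have "f ` J = J"
    using J(1) \<open>finite J\<close> by (simp add: P_def card_seteq)
  then have "bij_betw f J J"
    using \<open>finite J\<close> by (simp add: bij_betw_def eq_card_imp_inj_on)
  then show ?thesis
    using J(1) by (auto simp: P_def)
qed

section \<open>Exchange between trees, and trees rich in matchings\<close>

context tree_family
begin

text \<open>Let \<open>a\<close> count the edges \<open>(g k, f k)\<close> and \<open>b\<close> the
  edges \<open>(g k, f (q k))\<close>. Since \<open>q\<close> permutes \<open>K\<close>, these flows
  have the same marginals, hence are equal, and every edge counted by \<open>a\<close> is also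
  counted by \<open>b\<close>.\<close>

lemma exchange_unique:
  assumes T: "T \<in> \<G>" "T' \<in> \<G>" and "finite K" "bij_betw q K K"
    and edges: "\<And>k. k \<in> K \<Longrightarrow> (g k, f k) \<in> T" "\<And>k. k \<in> K \<Longrightarrow> (g k, f (q k)) \<in> T'"
    and "k \<in> K"
  shows "\<exists>l\<in>K. g l = g k \<and> f (q l) = f k"
proof -
  define a where "a i j = (\<Sum>k\<in>K. of_bool (g k = i \<and> f k = j) :: real)" for i j
  define b where "b i j = (\<Sum>k\<in>K. of_bool (g k = i \<and> f (q k) = j) :: real)" for i j
  have *: "(\<Sum>j\<in>UNIV. of_bool (P \<and> e = j)) = (of_bool P :: real)"
     "(\<Sum>i\<in>UNIV. of_bool (r = i \<and> P)) = (of_bool P :: real)"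
     for P and e :: 'e and r :: 'r
    by (simp_all add: of_bool_def if_distrib cong: if_cong)
  have "a = b"
  proof (rule flow_unique[OF T])
    show "0 \<le> a i j" "0 \<le> b i j" for i j
      by (simp_all add: a_def b_def sum_nonneg)
    show "(i, j) \<notin> T \<Longrightarrow> a i j = 0" "(i, j) \<notin> T' \<Longrightarrow> b i j = 0" for i j
      unfolding a_def b_def using edges by (auto intro!: sum.neutral)
    show "(\<Sum>j\<in>UNIV. a i j) = (\<Sum>j\<in>UNIV. b i j)" for i
      unfolding a_def b_def by (subst (1 2) sum.swap) (simp add: *)
    show "(\<Sum>i\<in>UNIV. a i j) = (\<Sum>i\<in>UNIV. b i j)" for j
      unfolding a_def b_def
      using sum.reindex_bij_betw[OF \<open>bij_betw q K K\<close>, of "\<lambda>k. of_bool (f k = j) :: real"]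
      by (subst (1 2) sum.swap) (simp add: *)
  qed
  moreover have "a (g k) (f k) > 0"
    unfolding a_def using \<open>finite K\<close> \<open>k \<in> K\<close> by (intro sum_pos2[of _ k]) auto
  ultimately have "b (g k) (f k) \<noteq> 0"
    by simp
  then show ?thesis
    unfolding b_def by (auto elim!: sum.not_neutral_contains_not_neutral)
qed

text \<open>
  Each element of \<open>\<rho>\<close> gets slightly more mass than a row, so any \<open>k > 0\<close> of them have at least
  \<open>k + 1\<close> neighbouring rows.
\<close>
lemma exists_tree_over_corank_one:
  assumes "card \<rho> < CARD('r)" "CARD('r) \<le> CARD('e)"
  obtains T where "T \<in> \<G>" "\<And>j. \<exists>i. (i, j) \<in> T"
    "\<And>i0. \<exists>m. inj_on m \<rho> \<and> (\<forall>j\<in>\<rho>. m j \<noteq> i0 \<and> (m j, j) \<in> T)"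
proof -
  define d where "d = real CARD('r)"
  have "d > 0" by (simp add: d_def)
  define n where "n = real (card (- \<rho>))"
  have "card (- \<rho>) > 0"
    using assms by (simp add: Compl_eq_Diff_UNIV card_Diff_subset)
  then have "n > 0" by (simp add: n_def)
  \<comment> \<open>The excess \<open>1 / d\<^sup>2\<close> is small enough:
    \<open>(d - 1) * (1 / d + 1 / d\<^sup>2) = 1 - 1 / d\<^sup>2\<close>. The positive remainder
    \<open>s\<close> is spread evenly over the complement of \<open>\<rho>\<close>, which forces
    every column to have an edge.\<close>
  define s where "s = 1 - real (card \<rho>) * (1 / d + 1 / d\<^sup>2)"
  have "real (card \<rho>) \<le> d - 1"
    using assms(1) by (simp add: d_def)
  then have "real (card \<rho>) * (1 / d + 1 / d\<^sup>2) \<le> (d - 1) * (1 / d + 1 / d\<^sup>2)"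
    using \<open>d > 0\<close> by (intro mult_right_mono) simp_all
  also have "\<dots> < 1"
    using \<open>d > 0\<close> by (simp add: field_simps power2_eq_square)
  finally have "s > 0" by (simp add: s_def)
  define y where "y j = (if j \<in> \<rho> then 1 / d + 1 / d\<^sup>2 else s / n)" for j :: 'e
  have ypos: "y j > 0" for j
    using \<open>d > 0\<close> \<open>n > 0\<close> \<open>s > 0\<close> by (simp add: y_def add_pos_pos)
  have "(\<Sum>j\<in>UNIV. y j) = real (card \<rho>) * (1 / d + 1 / d\<^sup>2) + n * (s / n)"
    unfolding y_def n_def by (simp add: sum.If_cases Compl_eq)
  also have "\<dots> = 1"
    using \<open>n > 0\<close> by (simp add: s_def)
  finally have "(\<Sum>j\<in>UNIV. y j) = 1" .
  then obtain T a where T: "T \<in> \<G>" and nonneg: "\<And>i j. 0 \<le> a i j"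
    and supp: "\<And>i j. (i, j) \<notin> T \<Longrightarrow> a i j = 0"
    and marg: "\<And>i. (\<Sum>j\<in>UNIV. a i j) = 1 / d" "\<And>j. (\<Sum>i\<in>UNIV. a i j) = y j"
    using flow_exists[of "\<lambda>_. 1 / d" y] ypos by (auto simp: d_def less_imp_le)
  have "\<exists>i. (i, j) \<in> T" for j
  proof (rule ccontr)
    assume "\<nexists>i. (i, j) \<in> T"
    then have "(\<Sum>i\<in>UNIV. a i j) = 0"
      using supp by simp
    then show False
      using marg(2)[of j] ypos[of j] by simp
  qed
  moreover have edge: "(i, j) \<in> T" if "0 < a i j" for i j
    using that supp by force
  \<comment> \<open>The flow is transposed here: the elements of \<open>\<rho>\<close> are the side
    with surplus, and the avoided vertex \<open>i0\<close> is a row.\<close>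
  have "\<exists>m. inj_on m \<rho> \<and> (\<forall>j\<in>\<rho>. m j \<noteq> i0 \<and> 0 < a (m j) j)" for i0
    using nonneg marg \<open>d > 0\<close>
    by (intro surplus_flow_matching[of "\<lambda>j i. a i j" \<rho> "1 / d + 1 / d\<^sup>2" "1 / d"]) (auto simp: y_def add_pos_pos)
  then have "\<exists>m. inj_on m \<rho> \<and> (\<forall>j\<in>\<rho>. m j \<noteq> i0 \<and> (m j, j) \<in> T)" for i0
    using edge by blast
  ultimately show thesis
    using that T by blast
qed

text \<open>Give each of the \<open>d\<close> rows mass \<open>1 / d\<close> and each of the
  \<open>d + 1\<close> elements of \<open>\<tau>\<close> mass \<open>1 / (d + 1)\<close>. The rows
  have the surplus, so they can be matched while avoiding any \<open>j0\<close>; the other columns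
  have mass zero, so all edges carrying flow end in \<open>\<tau>\<close>.\<close>

lemma exists_tree_over_circuit:
  fixes \<tau> :: "'e set"
  assumes "card \<tau> = CARD('r) + 1"
  obtains T where "T \<in> \<G>" "\<And>i. \<exists>j\<in>\<tau>. (i, j) \<in> T"
    "\<And>j0. \<exists>m. inj m \<and> (\<forall>i. m i \<in> \<tau> \<and> m i \<noteq> j0 \<and> (i, m i) \<in> T)"
proof -
  define d where "d = real CARD('r)"
  have "d > 0" by (simp add: d_def)
  define y where "y j = (if j \<in> \<tau> then 1 / (d + 1) else 0)" for j :: 'e
  have "(\<Sum>j\<in>UNIV. y j) = 1"
    using assms \<open>d > 0\<close> by (simp add: y_def sum.If_cases d_def)
  moreover have "0 \<le> y j" for j
    using \<open>d > 0\<close> by (simp add: y_def)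
  ultimately obtain T a where T: "T \<in> \<G>" and nonneg: "\<And>i j. 0 \<le> a i j"
    and supp: "\<And>i j. (i, j) \<notin> T \<Longrightarrow> a i j = 0"
    and marg: "\<And>i. (\<Sum>j\<in>UNIV. a i j) = 1 / d" "\<And>j. (\<Sum>i\<in>UNIV. a i j) = y j"
    using flow_exists[of "\<lambda>_. 1 / d" y] by (auto simp: d_def)
  have edge: "j \<in> \<tau> \<and> (i, j) \<in> T" if "0 < a i j" for i j
  proof
    show "(i, j) \<in> T"
      using that supp by force
    have "0 < y j"
      unfolding marg(2)[symmetric] using that nonneg by (intro sum_pos2[of _ i]) auto
    then show "j \<in> \<tau>"
      by (simp add: y_def split: if_splits)
  qed
  have match: "\<exists>m. inj_on m UNIV \<and> (\<forall>i\<in>UNIV. m i \<noteq> j0 \<and> 0 < a i (m i))" for j0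
    using nonneg marg \<open>d > 0\<close>
    by (intro surplus_flow_matching[of a UNIV "1 / d" "1 / (d + 1)"]) (auto simp: y_def field_simps)
  show thesis
  proof (rule that[OF T])
    show "\<exists>j\<in>\<tau>. (i, j) \<in> T" for i
      using match edge by blast
    show "\<exists>m. inj m \<and> (\<forall>i. m i \<in> \<tau> \<and> m i \<noteq> j0 \<and> (i, m i) \<in> T)" for j0
      using match[of j0] edge by blast
  qed
qed

end

section \<open>Signs of permutations\<close>

lemma bij_betw_order_enum: "finite S \<Longrightarrow> bij_betw (order_enum S) {..<card S} S"
  using bij_betw_nth[of "sorted_list_of_set S" "{..<card S}" S]
  by (simp add: order_enum_def[abs_def])

lemma bij_betw_order_index: "finite S \<Longrightarrow> bij_betw (order_index S) S {..<card S}"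
  unfolding order_index_def by (intro bij_betw_inv_into bij_betw_order_enum)

text \<open>Converts a matching, given as an injective choice of entries, into a permutation of
  positions whose sign can be taken.\<close>

lemma exists_permutation_nth:
  assumes "distinct ys" "length ys = n" "inj_on f {..<n}" "\<And>k. k < n \<Longrightarrow> f k \<in> set ys"
  shows "\<exists>p. p permutes {..<n} \<and> (\<forall>k<n. ys ! p k = f k)"
proof -
  have nth: "bij_betw ((!) ys) {..<n} (set ys)"
    using assms(1,2) by (intro bij_betw_nth) auto
  define g where "g = inv_into {..<n} ((!) ys) \<circ> f"
  have g: "ys ! g k = f k" "g k < n" if "k < n" for k
    using assms(4)[OF that] bij_betw_inv_into_right[OF nth, of "f k"]
      bij_betwE[OF bij_betw_inv_into[OF nth]] by (auto simp: g_def)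
  have "inj_on g {..<n}"
    using assms(3) g(1) unfolding inj_on_def by (metis lessThan_iff)
  moreover have "g ` {..<n} \<subseteq> {..<n}"
    using g(2) by auto
  ultimately have "bij_betw g {..<n} {..<n}"
    by (simp add: bij_betw_def endo_inj_surj)
  then have "restrict_id g {..<n} permutes {..<n}"
    by (rule permutes_restrict_id)
  then show ?thesis
    using g(1) by (intro exI[of _ "restrict_id g {..<n}"]) (simp add: restrict_id_def)
qed

lemma partner_perfect_matching:
  assumes "perfect_matching \<sigma> M"
  shows "(i, partner M i) \<in> M" "bij_betw (partner M) UNIV \<sigma>"
    "M = range (\<lambda>i. (i, partner M i))"
proof -
  have mem: "(i, partner M i) \<in> M" for i
    using assms theI'[of "\<lambda>j. (i, j) \<in> M"] unfolding perfect_matching_def partner_def by blast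
  then show "(i, partner M i) \<in> M" .
  have eq: "j = partner M i" if "(i, j) \<in> M" for i j
    using assms mem[of i] that unfolding perfect_matching_def by blast
  then show "M = range (\<lambda>i. (i, partner M i))"
    using mem by auto
  have "inj (partner M)"
    using assms mem unfolding perfect_matching_def inj_on_def by (metis SigmaD2 subsetD)
  moreover have "range (partner M) = \<sigma>"
  proof
    show "range (partner M) \<subseteq> \<sigma>"
      using assms mem unfolding perfect_matching_def by blast
    show "\<sigma> \<subseteq> range (partner M)"
      using assms eq unfolding perfect_matching_def by blast
  qed
  ultimately show "bij_betw (partner M) UNIV \<sigma>"
    by (simp add: bij_betw_def)
qed

lemma sign_compose_permutes:
  assumes "finite S" "p permutes S" "q permutes S"
  shows "sign (p \<circ> q) = sign p * sign q"
  using assms by (intro sign_compose) (auto intro: permutes_imp_permutation)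

lemma sign_compose_transpose:
  fixes n :: nat
  assumes "p permutes {..<n}" "a < n" "b < n" "a \<noteq> b"
  shows "p \<circ> Transposition.transpose a b permutes {..<n}" "Transposition.transpose a b \<circ> p permutes {..<n}"
    "sign (p \<circ> Transposition.transpose a b) = - sign p" "sign (Transposition.transpose a b \<circ> p) = - sign p"
  using assms permutes_swap_id[of a "{..<n}" b]
  by (auto simp: sign_compose_permutes[of "{..<n}"] sign_swap_id intro: permutes_compose)

text \<open>The cycle sending \<open>k\<close> to \<open>n\<close> and each of
  \<open>k + 1, ..., n\<close> one down. It renumbers the positions of a list when entry
  \<open>k\<close> is deleted, the deleted position being parked at the end.\<close>

definition cycle_to_end :: "nat \<Rightarrow> nat \<Rightarrow> nat \<Rightarrow> nat" where
  "cycle_to_end k n x = (if x = k then n else if k < x \<and> x \<le> n then x - 1 else x)"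

text \<open>Raising \<open>n\<close> by one composes the cycle with a transposition of neighbours,
  which flips the sign. The resulting power of \<open>-1\<close> accounts for the alternating signs
  in the exchange relation.\<close>

lemma cycle_to_end:
  assumes "k \<le> n"
  shows "cycle_to_end k n permutes {..<Suc n}" "sign (cycle_to_end k n) = (-1) ^ (n - k)"
proof -
  have "cycle_to_end k n permutes {..<Suc n} \<and> sign (cycle_to_end k n) = (-1) ^ (n - k)"
    using assms
  proof (induction n rule: dec_induct)
    case base
    have "cycle_to_end k k = id"
      by (auto simp: cycle_to_end_def fun_eq_iff)
    then show ?case
      by (auto simp: permutes_def)
  next
    case (step n)
    have eq: "cycle_to_end k (Suc n) = Transposition.transpose n (Suc n) \<circ> cycle_to_end k n"
      using step.hyps(1) by (auto simp: cycle_to_end_def fun_eq_iff Transposition.transpose_def)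
    have t: "Transposition.transpose n (Suc n) permutes {..<Suc (Suc n)}"
      by (rule permutes_swap_id) auto
    have c: "cycle_to_end k n permutes {..<Suc (Suc n)}"
      using step.IH by (auto intro: permutes_subset)
    have "sign (cycle_to_end k (Suc n)) = - sign (cycle_to_end k n)"
      unfolding eq by (rule sign_compose_transpose(4)[OF c]) auto
    moreover have "cycle_to_end k (Suc n) permutes {..<Suc (Suc n)}"
      unfolding eq using c t by (rule permutes_compose)
    ultimately show ?case
      using step by (simp add: Suc_diff_le)
  qed
  then show "cycle_to_end k n permutes {..<Suc n}" "sign (cycle_to_end k n) = (-1) ^ (n - k)"
    by auto
qed

abbreviation delete_nth :: "nat \<Rightarrow> 'a list \<Rightarrow> 'a list" where
  "delete_nth k ys \<equiv> take k ys @ drop (Suc k) ys"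

lemma nth_delete_nth_cycle_to_end:
  assumes "length ys = Suc n" "k \<le> n" "x \<le> n" "x \<noteq> k"
  shows "delete_nth k ys ! cycle_to_end k n x = ys ! x"
  using assms by (auto simp: cycle_to_end_def nth_append min_def)

lemma mset_delete_nth:
  assumes "k < length ys"
  shows "add_mset (ys ! k) (mset (delete_nth k ys)) = mset ys"
  by (subst (4) id_take_nth_drop[OF assms]) simp

section \<open>The sign map of a matching field\<close>

lemma sign_on_square: "sign_on S f * sign_on S f = 1"
  by (simp add: sign_on_def)

text \<open>The sign of the permutation sorting \<open>zs\<close> enters twice, through the
  alternating extension and through \<open>matching_sign\<close>. The two factors cancel, leaving a
  formula in terms of positions in \<open>zs\<close> alone.\<close>

lemma alternating_extension_matching:
  fixes M :: "'e::{finite,linorder} set \<Rightarrow> ('r::{finite,linorder} \<times> 'e) set" and A :: "'r \<Rightarrow> 'e \<Rightarrow> int"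
  assumes zs: "distinct zs" "length zs = CARD('r)"
    and p: "p permutes {..<CARD('r)}"
    and perfect: "perfect_matching (set zs) (M (set zs))"
    and partner: "\<And>k. k < CARD('r) \<Longrightarrow> partner (M (set zs)) (order_enum UNIV k) = zs ! p k"
  shows "alternating_extension (\<lambda>\<sigma>. matching_sign \<sigma> (M \<sigma>) * (\<Prod>(i, j)\<in>M \<sigma>. A i j)) zs =
    sign p * (\<Prod>k<CARD('r). A (order_enum UNIV k) (zs ! p k))"
proof -
  define s where "s = sign_on {..<CARD('r)} (\<lambda>k. order_index (set zs) (zs ! k))"
  have card: "card (set zs) = CARD('r)"
    using zs by (metis distinct_card)
  have "bij_betw ((!) zs) {..<CARD('r)} (set zs)"
    using zs by (intro bij_betw_nth) auto
  then have bij: "bij_betw (\<lambda>k. order_index (set zs) (zs ! k)) {..<CARD('r)} {..<CARD('r)}"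
    using bij_betw_trans[of "(!) zs" _ _ "order_index (set zs)"] bij_betw_order_index[of "set zs"]
    by (simp add: card comp_def)
  have "matching_sign (set zs) (M (set zs)) =
      sign_on {..<CARD('r)} ((\<lambda>k. order_index (set zs) (zs ! k)) \<circ> p)"
    unfolding matching_sign_def using partner by (intro sign_on_cong) auto
  also have "\<dots> = s * sign p"
    using bij p by (subst sign_on_compose) (simp_all add: permutes_imp_bij sign_on_permutes s_def)
  finally have sgn: "matching_sign (set zs) (M (set zs)) = s * sign p" .
  have "(\<Prod>(i, j)\<in>M (set zs). A i j) = (\<Prod>i\<in>UNIV. A i (partner (M (set zs)) i))"
    by (subst partner_perfect_matching(3)[OF perfect], subst prod.reindex) (auto simp: inj_on_def)
  also have "\<dots> = (\<Prod>k<CARD('r). A (order_enum UNIV k) (partner (M (set zs)) (order_enum UNIV k)))"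
    by (rule prod.reindex_bij_betw[symmetric], rule bij_betw_order_enum) simp
  also have "\<dots> = (\<Prod>k<CARD('r). A (order_enum UNIV k) (zs ! p k))"
    using partner by (intro prod.cong) auto
  finally show ?thesis
    using zs sign_on_square[of "{..<CARD('r)}" "\<lambda>k. order_index (set zs) (zs ! k)"]
    by (simp add: alternating_extension_def sgn s_def mult.assoc[symmetric])
qed

section \<open>The map \<open>chi\<close> computed from matchings in arbitrary trees\<close>

locale signed_matching_field = tree_family \<G>
  for \<G> :: "('r::{finite,linorder} \<times> 'e::{finite,linorder}) set set" +
  fixes M :: "'e set \<Rightarrow> ('r \<times> 'e) set" and A :: "'r \<Rightarrow> 'e \<Rightarrow> int"
  assumes perfect: "card \<sigma> = CARD('r) \<Longrightarrow> perfect_matching \<sigma> (M \<sigma>)"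
    and matching_in_tree: "card \<sigma> = CARD('r) \<Longrightarrow> \<exists>T\<in>\<G>. M \<sigma> \<subseteq> T"
    and sign_matrix: "A i j \<in> {1, -1}"
begin

abbreviation row :: "nat \<Rightarrow> 'r" where "row \<equiv> order_enum UNIV"

definition chi :: "'e list \<Rightarrow> int" where
  "chi = alternating_extension (\<lambda>\<sigma>. matching_sign \<sigma> (M \<sigma>) * (\<Prod>(i, j)\<in>M \<sigma>. A i j))"

lemma bij_betw_row: "bij_betw row {..<CARD('r)} UNIV"
  by (simp add: bij_betw_order_enum)

lemma row_eq_iff: "k < CARD('r) \<Longrightarrow> l < CARD('r) \<Longrightarrow> row k = row l \<longleftrightarrow> k = l"
  using bij_betw_row by (auto simp: bij_betw_def inj_on_def)

lemma rowE:
  obtains k where "k < CARD('r)" "row k = i"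
proof -
  have "i \<in> row ` {..<CARD('r)}"
    using bij_betw_row by (simp add: bij_betw_def)
  then show thesis
    using that by auto
qed

lemma matching_permutation:
  assumes "distinct zs" "length zs = CARD('r)"
  obtains p T where "p permutes {..<CARD('r)}" "T \<in> \<G>" "\<And>k. k < CARD('r) \<Longrightarrow> (row k, zs ! p k) \<in> T"
    "\<And>k. k < CARD('r) \<Longrightarrow> partner (M (set zs)) (row k) = zs ! p k"
proof -
  have card: "card (set zs) = CARD('r)"
    using assms by (metis distinct_card)
  note pm = partner_perfect_matching[OF perfect[OF card]]
  obtain T where T: "T \<in> \<G>" "M (set zs) \<subseteq> T"
    using matching_in_tree[OF card] by blast
  have "bij_betw (partner (M (set zs)) \<circ> row) {..<CARD('r)} (set zs)"
    using bij_betw_row pm(2) by (rule bij_betw_trans)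
  then have "inj_on (partner (M (set zs)) \<circ> row) {..<CARD('r)}"
    "\<And>k. k < CARD('r) \<Longrightarrow> (partner (M (set zs)) \<circ> row) k \<in> set zs"
    by (auto simp: bij_betw_def)
  from exists_permutation_nth[OF assms this]
  obtain p where p: "p permutes {..<CARD('r)}" "\<forall>k<CARD('r). zs ! p k = (partner (M (set zs)) \<circ> row) k"
    by blast
  show thesis
  proof (rule that[OF p(1) T(1)])
    show "(row k, zs ! p k) \<in> T" if "k < CARD('r)" for k
      using p(2) pm(1) T(2) that by auto
  qed (use p(2) in auto)
qed

lemma tree_permutation:
  assumes "distinct zs" "length zs = CARD('r)"
  obtains p T where "p permutes {..<CARD('r)}" "T \<in> \<G>" "\<And>k. k < CARD('r) \<Longrightarrow> (row k, zs ! p k) \<in> T"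
  by (rule matching_permutation[OF assms]) (rule that)

text \<open>Uniqueness of flows forces the matching given by \<open>p\<close> to be the one of the matching field.\<close>
lemma chi_eq:
  assumes zs: "distinct zs" "length zs = CARD('r)" and p: "p permutes {..<CARD('r)}"
    and T: "T \<in> \<G>" "\<And>k. k < CARD('r) \<Longrightarrow> (row k, zs ! p k) \<in> T"
  shows "chi zs = sign p * (\<Prod>k<CARD('r). A (row k) (zs ! p k))"
  unfolding chi_def
proof (rule alternating_extension_matching[OF zs p])
  show "perfect_matching (set zs) (M (set zs))"
    using perfect zs by (metis distinct_card)
  fix k assume k: "k < CARD('r)"
  obtain p' T' where p': "p' permutes {..<CARD('r)}" "T' \<in> \<G>" "\<And>k. k < CARD('r) \<Longrightarrow> (row k, zs ! p' k) \<in> T'"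
    "\<And>k. k < CARD('r) \<Longrightarrow> partner (M (set zs)) (row k) = zs ! p' k"
    by (rule matching_permutation[OF zs]) (rule that)
  have q: "p ((inv p \<circ> p') l) = p' l" for l
    using p by (simp add: permutes_inverses)
  \<comment> \<open>Permuting by \<open>inv p \<circ> p'\<close> turns the edges of the given
    matching into those of the matching field, so both matchings have the same edges.\<close>
  have "\<exists>l\<in>{..<CARD('r)}. row l = row k \<and> zs ! p ((inv p \<circ> p') l) = zs ! p k"
  proof (rule exchange_unique[OF T(1) p'(2), where f = "\<lambda>k. zs ! p k"])
    show "bij_betw (inv p \<circ> p') {..<CARD('r)} {..<CARD('r)}"
      by (rule permutes_imp_bij[OF permutes_compose[OF p'(1) permutes_inv[OF p]]])
    show "(row l, zs ! p l) \<in> T" "(row l, zs ! p ((inv p \<circ> p') l)) \<in> T'" if "l \<in> {..<CARD('r)}" for l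
      unfolding q using T(2) p'(3) that by auto
  qed (use k in auto)
  then obtain l where l: "l < CARD('r)" "row l = row k" "zs ! p' l = zs ! p k"
    unfolding q by blast
  then have "l = k"
    using k row_eq_iff by blast
  then show "partner (M (set zs)) (row k) = zs ! p k"
    using p'(4)[OF k] l(3) by simp
qed

lemma abs_A: "\<bar>A i j\<bar> = 1"
  using sign_matrix[of i j] by (elim insertE emptyE) simp_all

lemma abs_chi:
  assumes "distinct zs" "length zs = CARD('r)"
  shows "\<bar>chi zs\<bar> = 1"
proof -
  obtain p T where "p permutes {..<CARD('r)}" "T \<in> \<G>" "\<And>k. k < CARD('r) \<Longrightarrow> (row k, zs ! p k) \<in> T"
    by (rule tree_permutation[OF assms]) (rule that)
  then have "chi zs = sign p * (\<Prod>k<CARD('r). A (row k) (zs ! p k))"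
    by (rule chi_eq[OF assms])
  then show ?thesis
    by (simp add: abs_mult abs_prod abs_A)
qed

lemma chi_not_distinct: "\<not> distinct zs \<Longrightarrow> chi zs = 0"
  by (simp add: chi_def alternating_extension_def)

text \<open>Permuting the list by \<open>q\<close> keeps the matching and only changes its encoding
  from \<open>p\<close> to \<open>inv q \<circ> p\<close>; the product of entries of
  \<open>A\<close> stays the same.\<close>

lemma alternating_chi: "alternating CARD('r) chi"
  unfolding alternating_def
proof (intro allI impI conjI)
  fix zs :: "'e list" and q assume len: "length zs = CARD('r)" and q: "q permutes {..<CARD('r)}"
  show "chi (permute_list q zs) = sign q * chi zs"
  proof (cases "distinct zs")
    case True
    obtain p T where p: "p permutes {..<CARD('r)}" "T \<in> \<G>" "\<And>k. k < CARD('r) \<Longrightarrow> (row k, zs ! p k) \<in> T"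
      by (rule tree_permutation[OF True len]) (rule that)
    have qp: "inv q \<circ> p permutes {..<CARD('r)}"
      using p(1) q by (intro permutes_compose permutes_inv)
    have nth: "permute_list q zs ! (inv q \<circ> p) k = zs ! p k" if "k < CARD('r)" for k
      using that q len permutes_in_image[OF qp, of k]
      by (subst permute_list_nth) (auto simp: permutes_inverses)
    have "chi (permute_list q zs) = sign (inv q \<circ> p) * (\<Prod>k<CARD('r). A (row k) (permute_list q zs ! (inv q \<circ> p) k))"
      using True len q p(3) nth by (intro chi_eq[OF _ _ qp p(2)]) auto
    also have "(\<Prod>k<CARD('r). A (row k) (permute_list q zs ! (inv q \<circ> p) k)) = (\<Prod>k<CARD('r). A (row k) (zs ! p k))"
      by (intro prod.cong refl arg_cong2[of _ _ _ _ A] nth) simp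
    also have "sign (inv q \<circ> p) = sign q * sign p"
      using p(1) q sign_compose_permutes[of "{..<CARD('r)}" "inv q" p]
      by (simp add: permutes_inv sign_inverse permutes_imp_permutation[of "{..<CARD('r)}"])
    finally show ?thesis
      using chi_eq[OF True len p] by simp
  next
    case False
    then show ?thesis
      using len q by (simp add: chi_not_distinct)
  qed
qed (simp add: chi_not_distinct)

section \<open>Values of \<open>chi\<close> on a list of \<open>d + 1\<close> entries with one
  deleted\<close>

text \<open>A matching of \<open>ys\<close> without one entry is encoded by a permutation
  \<open>p\<close> of \<open>d + 1\<close> positions, with \<open>p d\<close> the deleted one.
  Composing with \<open>cycle_to_end\<close> yields the permutation for the shortened list at the
  cost of \<open>(-1) ^ (d - p d)\<close>. In this form, changing the deleted entry becomes a
  transposition.\<close>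

lemma chi_delete_nth:
  assumes ys: "length ys = Suc CARD('r)" "distinct (delete_nth (p CARD('r)) ys)" and p: "p permutes {..<Suc CARD('r)}"
    and T: "T \<in> \<G>" "\<And>k. k < CARD('r) \<Longrightarrow> (row k, ys ! p k) \<in> T"
  shows "(-1) ^ p CARD('r) * chi (delete_nth (p CARD('r)) ys) = (-1) ^ CARD('r) * sign p * (\<Prod>k<CARD('r). A (row k) (ys ! p k))"
proof -
  have le: "p k \<le> CARD('r)" if "k \<le> CARD('r)" for k
    using permutes_in_image[OF p, of k] that by simp
  note c = cycle_to_end[OF le[OF order_refl]]
  define \<pi> where "\<pi> = cycle_to_end (p CARD('r)) CARD('r) \<circ> p"
  have "\<pi> permutes {..<Suc CARD('r)}"
    unfolding \<pi>_def using p c(1) by (rule permutes_compose)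
  moreover have "\<pi> CARD('r) = CARD('r)"
    by (simp add: \<pi>_def cycle_to_end_def)
  ultimately have \<pi>: "\<pi> permutes {..<CARD('r)}"
    by (elim permutes_superset) auto
  have nth: "delete_nth (p CARD('r)) ys ! \<pi> k = ys ! p k" if "k < CARD('r)" for k
  proof -
    have "p k \<noteq> p CARD('r)"
      using that permutes_inj[OF p] by (auto dest: injD)
    then show ?thesis
      unfolding \<pi>_def comp_def
      by (intro nth_delete_nth_cycle_to_end[OF ys(1)]) (use le that in auto)
  qed
  have "chi (delete_nth (p CARD('r)) ys) = sign \<pi> * (\<Prod>k<CARD('r). A (row k) (delete_nth (p CARD('r)) ys ! \<pi> k))"
    using ys(1) le[of "CARD('r)"] nth T(2) by (intro chi_eq[OF ys(2) _ \<pi> T(1)]) auto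
  also have "(\<Prod>k<CARD('r). A (row k) (delete_nth (p CARD('r)) ys ! \<pi> k)) = (\<Prod>k<CARD('r). A (row k) (ys ! p k))"
    by (intro prod.cong refl arg_cong2[of _ _ _ _ A] nth) simp
  also have "sign \<pi> = (-1) ^ (CARD('r) - p CARD('r)) * sign p"
    unfolding \<pi>_def using c p by (simp add: sign_compose_permutes[of "{..<Suc CARD('r)}"])
  finally show ?thesis
    using le[of "CARD('r)"] by (simp add: mult.assoc[symmetric] power_add[symmetric])
qed

text \<open>The converse encoding: the permutation matching the shortened list fixes
  \<open>d\<close>, and the inverse cycle carries it back to positions in \<open>ys\<close>.\<close>

lemma exists_permutation_delete_nth:
  assumes ys: "length ys = Suc CARD('r)" "distinct (delete_nth a ys)" and "a \<le> CARD('r)"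
  obtains p T where "p permutes {..<Suc CARD('r)}" "p CARD('r) = a" "T \<in> \<G>" "\<And>k. k < CARD('r) \<Longrightarrow> (row k, ys ! p k) \<in> T"
proof -
  have "length (delete_nth a ys) = CARD('r)"
    using ys(1) \<open>a \<le> CARD('r)\<close> by simp
  then obtain \<pi> T where \<pi>: "\<pi> permutes {..<CARD('r)}" "T \<in> \<G>" "\<And>k. k < CARD('r) \<Longrightarrow> (row k, delete_nth a ys ! \<pi> k) \<in> T"
    by (rule tree_permutation[OF ys(2)]) (rule that)
  note c = cycle_to_end(1)[OF \<open>a \<le> CARD('r)\<close>]
  define p where "p = inv (cycle_to_end a CARD('r)) \<circ> \<pi>"
  have "\<pi> permutes {..<Suc CARD('r)}"
    using \<pi>(1) by (auto intro: permutes_subset)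
  then have p: "p permutes {..<Suc CARD('r)}"
    unfolding p_def using c by (intro permutes_compose permutes_inv)
  have cp: "cycle_to_end a CARD('r) (p k) = \<pi> k" for k
    unfolding p_def using c by (simp add: permutes_inverses)
  have pd: "p CARD('r) = a"
  proof (rule injD[OF permutes_inj[OF c]])
    show "cycle_to_end a CARD('r) (p CARD('r)) = cycle_to_end a CARD('r) a"
      unfolding cp using permutes_not_in[OF \<pi>(1), of "CARD('r)"] by (simp add: cycle_to_end_def)
  qed
  show thesis
  proof (rule that[OF p pd \<pi>(2)])
    fix k assume "k < CARD('r)"
    then have "p k \<noteq> a" "p k \<le> CARD('r)"
      using inj_eq[OF permutes_inj[OF p], of k "CARD('r)"] pd permutes_in_image[OF p, of k] by auto
    then have "delete_nth a ys ! \<pi> k = ys ! p k"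
      using nth_delete_nth_cycle_to_end[OF ys(1) \<open>a \<le> CARD('r)\<close>, of "p k"] by (simp add: cp)
    then show "(row k, ys ! p k) \<in> T"
      using \<pi>(3)[OF \<open>k < CARD('r)\<close>] by simp
  qed
qed

text \<open>Deleting either of two equal entries leaves the same matching, and the two encodings
  differ by the transposition of \<open>a\<close> and \<open>b\<close>. If one shortened list still
  has a repetition, so does the other, and both values vanish.\<close>

lemma chi_delete_repeated:
  assumes ys: "length ys = Suc CARD('r)" "ys ! a = ys ! b" "a \<le> CARD('r)" "b \<le> CARD('r)" "a \<noteq> b"
  shows "(-1) ^ a * chi (delete_nth a ys) = - ((-1) ^ b * chi (delete_nth b ys))"
proof -
  have "mset (delete_nth a ys) = mset (delete_nth b ys)"
    using mset_delete_nth[of a ys] mset_delete_nth[of b ys] ys by (metis add_mset_add_mset_same_iff less_Suc_eq_le)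
  then have dist: "distinct (delete_nth a ys) \<longleftrightarrow> distinct (delete_nth b ys)"
    by (rule mset_eq_imp_distinct_iff)
  show ?thesis
  proof (cases "distinct (delete_nth a ys)")
    case True
    obtain p T where p: "p permutes {..<Suc CARD('r)}" "p CARD('r) = a" "T \<in> \<G>" "\<And>k. k < CARD('r) \<Longrightarrow> (row k, ys ! p k) \<in> T"
      by (rule exists_permutation_delete_nth[OF ys(1) True ys(3)]) (rule that)
    define p' where "p' = Transposition.transpose a b \<circ> p"
    have p': "p' permutes {..<Suc CARD('r)}" "sign p' = - sign p"
      unfolding p'_def using sign_compose_transpose[OF p(1)] ys by auto
    have "p' CARD('r) = b"
      by (simp add: p'_def p(2))
    have nth: "ys ! p' k = ys ! p k" for k
      using ys(2) by (simp add: p'_def Transposition.transpose_def)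
    have "(-1) ^ a * chi (delete_nth a ys) = (-1) ^ CARD('r) * sign p * (\<Prod>k<CARD('r). A (row k) (ys ! p k))"
      using chi_delete_nth[OF ys(1) _ p(1) p(3,4)] True p(2) by simp
    moreover have "(-1) ^ b * chi (delete_nth b ys) = (-1) ^ CARD('r) * sign p' * (\<Prod>k<CARD('r). A (row k) (ys ! p' k))"
      using chi_delete_nth[OF ys(1) _ p'(1) p(3)] True dist \<open>p' CARD('r) = b\<close> p(4) nth by simp
    ultimately show ?thesis
      by (simp add: nth p'(2))
  next
    case False
    then have "\<not> distinct (delete_nth b ys)"
      unfolding dist .
    from chi_not_distinct[OF False] chi_not_distinct[OF this] show ?thesis
      by simp
  qed
qed

section \<open>Signed circuits and cocircuits along trees\<close>

text \<open>Pick a neighbour \<open>ys ! k\<close> of row \<open>i\<close> and a matching in the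
  tree that omits it; let \<open>ys ! l\<close> be the partner of \<open>i\<close>. Rematching
  \<open>i\<close> to \<open>ys ! k\<close> gives a matching omitting \<open>ys ! l\<close>. The two
  differ by one transposition and by the edge at \<open>i\<close>, so the two products are
  opposite.\<close>

lemma circuit_tree:
  assumes ys: "length ys = Suc CARD('r)" "distinct ys"
  obtains T where "T \<in> \<G>"
    "\<And>i. \<exists>k\<le>CARD('r). \<exists>l\<le>CARD('r). (i, ys ! k) \<in> T \<and> (i, ys ! l) \<in> T \<and>
       (-1) ^ k * chi (delete_nth k ys) * A i (ys ! k) = - ((-1) ^ l * chi (delete_nth l ys) * A i (ys ! l))"
proof -
  have "card (set ys) = CARD('r) + 1"
    using ys by (simp add: distinct_card)
  then obtain T where T: "T \<in> \<G>" "\<And>i. \<exists>j\<in>set ys. (i, j) \<in> T"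
    "\<And>j0. \<exists>m. inj m \<and> (\<forall>i. m i \<in> set ys \<and> m i \<noteq> j0 \<and> (i, m i) \<in> T)"
    using exists_tree_over_circuit[of "set ys"] by blast
  show thesis
  proof (rule that[OF T(1)])
    fix i
    obtain k0 where k0: "k0 < CARD('r)" "row k0 = i"
      by (rule rowE)
    obtain k where k: "k \<le> CARD('r)" "(i, ys ! k) \<in> T"
      using T(2)[of i] ys(1) by (metis in_set_conv_nth less_Suc_eq_le)
    obtain m where m: "inj m" "\<And>i. m i \<in> set ys \<and> m i \<noteq> ys ! k \<and> (i, m i) \<in> T"
      using T(3)[of "ys ! k"] by blast
    \<comment> \<open>The omitted entry is placed in the last slot, as the encoding of
      \<open>chi_delete_nth\<close> requires.\<close>
    define f where "f k' = (if k' < CARD('r) then m (row k') else ys ! k)" for k'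
    have "inj_on f {..<Suc CARD('r)}"
    proof (rule inj_onI)
      fix x y assume *: "x \<in> {..<Suc CARD('r)}" "y \<in> {..<Suc CARD('r)}" "f x = f y"
      have "x < CARD('r) \<longleftrightarrow> y < CARD('r)"
        using *(3) m(2) by (metis f_def)
      then show "x = y"
        using * row_eq_iff[of x y] injD[OF m(1)] by (auto simp: f_def split: if_splits)
    qed
    moreover have "f x \<in> set ys" for x
      using m(2) k(1) ys(1) by (simp add: f_def)
    ultimately obtain p where p: "p permutes {..<Suc CARD('r)}" "\<And>x. x < Suc CARD('r) \<Longrightarrow> ys ! p x = f x"
      using exists_permutation_nth[OF ys(2,1)] by blast
    have le: "p x \<le> CARD('r)" if "x \<le> CARD('r)" for x
      using permutes_in_image[OF p(1), of x] that by simp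
    have "ys ! p CARD('r) = ys ! k"
      using p(2)[of "CARD('r)"] by (simp add: f_def)
    then have pd: "p CARD('r) = k"
      using ys k(1) le[of "CARD('r)"] by (simp add: nth_eq_iff_index_eq)
    define l where "l = p k0"
    have edge: "(row x, ys ! p x) \<in> T" if "x < CARD('r)" for x
      using p(2)[of x] m(2) that by (simp add: f_def)
    have "k0 \<noteq> CARD('r)"
      using k0(1) by simp
    define p' where "p' = p \<circ> Transposition.transpose k0 CARD('r)"
    have p': "p' permutes {..<Suc CARD('r)}" "sign p' = - sign p"
      unfolding p'_def using sign_compose_transpose[OF p(1)] k0(1) by auto
    have p'_eq: "p' CARD('r) = l" "p' k0 = k" "\<And>x. x < CARD('r) \<Longrightarrow> x \<noteq> k0 \<Longrightarrow> p' x = p x"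
      by (auto simp: p'_def l_def pd Transposition.transpose_def)
    have edge': "(row x, ys ! p' x) \<in> T" if "x < CARD('r)" for x
      using edge[OF that] p'_eq k0(2) k(2) that by (cases "x = k0") auto
    define R where "R = (\<Prod>x\<in>{..<CARD('r)} - {k0}. A (row x) (ys ! p x))"
    have dist: "distinct (delete_nth x ys)" for x
      using ys(2) by (simp add: set_take_disj_set_drop_if_distinct)
    have "(\<Prod>x<CARD('r). A (row x) (ys ! p x)) = A i (ys ! l) * R"
      using k0 by (subst prod.remove[of _ k0]) (auto simp: R_def l_def)
    then have 1: "(-1) ^ k * chi (delete_nth k ys) = (-1) ^ CARD('r) * sign p * (A i (ys ! l) * R)"
      using chi_delete_nth[OF ys(1) _ p(1) T(1) edge] dist[of k] pd by simp
    have "(\<Prod>x<CARD('r). A (row x) (ys ! p' x)) = A i (ys ! k) * (\<Prod>x\<in>{..<CARD('r)} - {k0}. A (row x) (ys ! p' x))"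
      using k0 by (subst prod.remove[of _ k0]) (auto simp: p'_eq)
    also have "(\<Prod>x\<in>{..<CARD('r)} - {k0}. A (row x) (ys ! p' x)) = R"
      unfolding R_def by (intro prod.cong refl) (auto simp: p'_eq)
    finally have 2: "(-1) ^ l * chi (delete_nth l ys) = (-1) ^ CARD('r) * (- sign p) * (A i (ys ! k) * R)"
      using chi_delete_nth[OF ys(1) _ p'(1) T(1) edge'] dist[of l] le[of k0] k0(1) p'(2) p'_eq(1)
      by (simp add: l_def)
    have "l \<le> CARD('r)" "(i, ys ! l) \<in> T"
      using le[of k0] edge[of k0] k0 by (auto simp: l_def)
    then show "\<exists>k\<le>CARD('r). \<exists>l\<le>CARD('r). (i, ys ! k) \<in> T \<and> (i, ys ! l) \<in> T \<and>
       (-1) ^ k * chi (delete_nth k ys) * A i (ys ! k) = - ((-1) ^ l * chi (delete_nth l ys) * A i (ys ! l))"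
      using k 1 2 by (intro exI[of _ k] exI[of _ l] conjI) (simp_all add: mult_ac)
  qed
qed

text \<open>For each row \<open>i\<close> the tree contains exactly one matching of
  \<open>xs\<close> into the other rows, and \<open>\<mu> i\<close> is its signed product. An edge
  \<open>(i, j)\<close> with \<open>j\<close> outside \<open>xs\<close> completes it to a matching
  of \<open>xs @ [j]\<close>. If \<open>j\<close> lies in \<open>xs\<close>, moving \<open>j\<close>
  from its partner \<open>i'\<close> to \<open>i\<close> yields the matching avoiding
  \<open>i'\<close>, whose encoding differs by a transposition.\<close>

lemma cocircuit_tree:
  assumes xs: "Suc (length xs) = CARD('r)" "distinct xs" and "CARD('r) \<le> CARD('e)"
  obtains T \<mu> where "T \<in> \<G>" "\<And>j. \<exists>i. (i, j) \<in> T" "\<And>i. \<bar>\<mu> i\<bar> = 1"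
    "\<And>i j. (i, j) \<in> T \<Longrightarrow> j \<notin> set xs \<Longrightarrow> chi (xs @ [j]) = \<mu> i * A i j"
    "\<And>j. j \<in> set xs \<Longrightarrow> \<exists>i i'. (i, j) \<in> T \<and> (i', j) \<in> T \<and> \<mu> i * A i j = - (\<mu> i' * A i' j)"
proof -
  have "card (set xs) < CARD('r)"
    using xs by (simp add: distinct_card)
  then obtain T where T: "T \<in> \<G>" "\<And>j. \<exists>i. (i, j) \<in> T"
    "\<And>i0. \<exists>m. inj_on m (set xs) \<and> (\<forall>j\<in>set xs. m j \<noteq> i0 \<and> (m j, j) \<in> T)"
    using exists_tree_over_corank_one[of "set xs"] \<open>CARD('r) \<le> CARD('e)\<close> by blast
  define n where "n = length xs"
  have card_row: "CARD('r) = Suc n"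
    using xs(1) by (simp add: n_def)
  \<comment> \<open>The free row \<open>k0\<close> is assigned the position \<open>n\<close>, which
    is where \<open>j\<close> will stand in \<open>xs @ [j]\<close>.\<close>
  define Q where "Q k0 \<pi> \<longleftrightarrow> \<pi> permutes {..<CARD('r)} \<and> \<pi> k0 = n \<and> (\<forall>k<CARD('r). k \<noteq> k0 \<longrightarrow> (row k, xs ! \<pi> k) \<in> T)"
    for k0 \<pi>
  have Q_exists: "\<exists>\<pi>. Q k0 \<pi>" if "k0 < CARD('r)" for k0
  proof -
    obtain m where m: "inj_on m (set xs)" "\<And>j. j \<in> set xs \<Longrightarrow> m j \<noteq> row k0 \<and> (m j, j) \<in> T"
      using T(3)[of "row k0"] by blast
    define f where "f k = (if k < n then m (xs ! k) else row k0)" for k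
    have "inj_on f {..<CARD('r)}"
    proof (rule inj_onI)
      fix x y assume *: "x \<in> {..<CARD('r)}" "y \<in> {..<CARD('r)}" "f x = f y"
      have "x < n \<longleftrightarrow> y < n"
        using *(3) m(2) nth_mem[of _ xs] unfolding f_def n_def by metis
      then show "x = y"
        using * inj_onD[OF m(1), of "xs ! x" "xs ! y"] xs(2)
        by (auto simp: f_def n_def card_row nth_eq_iff_index_eq split: if_splits)
    qed
    \<comment> \<open>The matching leads from \<open>xs\<close> to rows, so \<open>p\<close> maps
      positions to row indices; the permutation wanted for \<open>Q\<close> is its inverse.\<close>
    then obtain p where p: "p permutes {..<CARD('r)}" "\<And>k. k < CARD('r) \<Longrightarrow> row (p k) = f k"
      using exists_permutation_nth[of "sorted_list_of_set (UNIV :: 'r set)" "CARD('r)" f]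
      by (auto simp: order_enum_def)
    have ip: "inv p permutes {..<CARD('r)}"
      using p(1) by (rule permutes_inv)
    have inv: "p (inv p k) = k" "inv p (p k) = k" for k
      using p(1) by (simp_all add: permutes_inverses)
    have lt: "p k < CARD('r)" "inv p k < CARD('r)" if "k < CARD('r)" for k
      using that permutes_in_image[OF p(1), of k] permutes_in_image[OF ip, of k] by auto
    have "row (p n) = row k0"
      using p(2)[of n] by (simp add: f_def card_row)
    then have "p n = k0"
      using row_eq_iff lt(1)[of n] that by (simp add: card_row)
    then have "inv p k0 = n"
      using inv(2) by metis
    moreover have "(row k, xs ! inv p k) \<in> T" if "k < CARD('r)" "k \<noteq> k0" for k
    proof -
      have "inv p k \<noteq> n"
        using that(2) inv(1) \<open>p n = k0\<close> by metis
      then have "inv p k < n"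
        using lt(2)[OF that(1)] by (simp add: card_row)
      moreover have "row k = f (inv p k)"
        using p(2)[OF lt(2)[OF that(1)]] inv(1) by simp
      ultimately show ?thesis
        using m(2) by (simp add: f_def n_def)
    qed
    ultimately show ?thesis
      using ip unfolding Q_def by blast
  qed
  have Q_unique: "\<pi>' = \<pi>" if Q: "Q k0 \<pi>" "Q k0 \<pi>'" and "k0 < CARD('r)" for k0 \<pi> \<pi>'
  proof -
    have \<pi>: "\<pi> permutes {..<CARD('r)}" "\<pi>' permutes {..<CARD('r)}" "\<pi> k0 = n" "\<pi>' k0 = n"
      using Q by (auto simp: Q_def)
    have q: "\<pi> ((inv \<pi> \<circ> \<pi>') k) = \<pi>' k" for k
      using \<pi>(1) by (simp add: permutes_inverses)
    have lt: "\<pi> k < n" "\<pi>' k < n" if "k < CARD('r)" "k \<noteq> k0" for k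
      using that \<pi> permutes_in_image[OF \<pi>(1), of k] permutes_in_image[OF \<pi>(2), of k]
        injD[OF permutes_inj[OF \<pi>(1)], of k k0] injD[OF permutes_inj[OF \<pi>(2)], of k k0]
      by (auto simp: card_row less_Suc_eq)
    have "inv \<pi> \<circ> \<pi>' permutes {..<CARD('r)}"
      using \<pi> by (intro permutes_compose permutes_inv)
    moreover have "(inv \<pi> \<circ> \<pi>') k0 = k0"
      using \<pi> by (simp add: permutes_inv_eq)
    \<comment> \<open>Both matchings leave row \<open>k0\<close> free, so they can be compared by an
      exchange on the remaining rows, with \<open>T\<close> on both sides.\<close>
    ultimately have "inv \<pi> \<circ> \<pi>' permutes {..<CARD('r)} - {k0}"
      by (elim permutes_superset) auto
    then have bij: "bij_betw (inv \<pi> \<circ> \<pi>') ({..<CARD('r)} - {k0}) ({..<CARD('r)} - {k0})"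
      by (rule permutes_imp_bij)
    have "\<pi>' k = \<pi> k" for k
    proof (cases "k < CARD('r) \<and> k \<noteq> k0")
      case True
      have "\<exists>l\<in>{..<CARD('r)} - {k0}. row l = row k \<and> xs ! \<pi> ((inv \<pi> \<circ> \<pi>') l) = xs ! \<pi> k"
      proof (rule exchange_unique[OF T(1) T(1) _ bij, where f = "\<lambda>k. xs ! \<pi> k"])
        show "(row l, xs ! \<pi> l) \<in> T" "(row l, xs ! \<pi> ((inv \<pi> \<circ> \<pi>') l)) \<in> T" if "l \<in> {..<CARD('r)} - {k0}" for l
          unfolding q using that Q by (auto simp: Q_def)
      qed (use True in auto)
      then obtain l where l: "l < CARD('r)" "row l = row k" "xs ! \<pi>' l = xs ! \<pi> k"
        unfolding q by blast
      then have "l = k"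
        using True row_eq_iff by blast
      then have "xs ! \<pi>' k = xs ! \<pi> k"
        using l(3) by simp
      then show ?thesis
        using lt True xs(2) by (simp add: nth_eq_iff_index_eq n_def)
    next
      case False
      then show ?thesis
        using \<pi> permutes_not_in[OF \<pi>(1), of k] permutes_not_in[OF \<pi>(2), of k] by auto
    qed
    then show ?thesis
      by (simp add: fun_eq_iff)
  qed
  define c where "c k0 \<pi> = sign \<pi> * (\<Prod>k\<in>{..<CARD('r)} - {k0}. A (row k) (xs ! \<pi> k))" for k0 \<pi>
  \<comment> \<open>By \<open>Q_unique\<close> the choice is immaterial, so \<open>\<mu>\<close> may
    be evaluated at any encoding at hand.\<close>
  define \<mu> where "\<mu> i = (let k0 = order_index UNIV i in c k0 (SOME \<pi>. Q k0 \<pi>))" for i :: 'r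
  have index_row: "order_index UNIV (row k) = k" if "k < CARD('r)" for k
    using bij_betw_inv_into_left[OF bij_betw_row] that by (simp add: order_index_def)
  have \<mu>: "\<mu> (row k0) = c k0 \<pi>" if "Q k0 \<pi>" "k0 < CARD('r)" for k0 \<pi>
    using Q_unique[OF that(1) someI[of "Q k0", OF that(1)] that(2)] index_row[OF that(2)]
    by (simp add: \<mu>_def)
  show thesis
  proof (rule that[OF T(1,2)])
    fix i
    obtain k0 where k0: "k0 < CARD('r)" "row k0 = i"
      by (rule rowE)
    then obtain \<pi> where "Q k0 \<pi>"
      using Q_exists by blast
    then have "\<mu> i = c k0 \<pi>"
      using \<mu> k0 by blast
    then show "\<bar>\<mu> i\<bar> = 1"
      by (simp add: c_def abs_mult abs_prod abs_A)
  next
    fix i j assume ij: "(i, j) \<in> T" "j \<notin> set xs"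
    obtain k0 where "k0 < CARD('r)" "row k0 = i"
      by (rule rowE)
    then obtain \<pi> where k0: "k0 < CARD('r)" "row k0 = i" "Q k0 \<pi>"
      using Q_exists by blast
    then have \<pi>: "\<pi> permutes {..<CARD('r)}" "\<pi> k0 = n" "\<And>k. k < CARD('r) \<Longrightarrow> k \<noteq> k0 \<Longrightarrow> (row k, xs ! \<pi> k) \<in> T"
      by (auto simp: Q_def)
    have nth: "(xs @ [j]) ! \<pi> k = (if k = k0 then j else xs ! \<pi> k)" if "k < CARD('r)" for k
    proof (cases "k = k0")
      case False
      then have "\<pi> k < n"
        using \<pi>(2) permutes_in_image[OF \<pi>(1), of k] injD[OF permutes_inj[OF \<pi>(1)], of k k0] that
        by (auto simp: card_row less_Suc_eq)
      then show ?thesis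
        using False by (simp add: nth_append n_def)
    qed (simp add: \<pi>(2) n_def)
    have "chi (xs @ [j]) = sign \<pi> * (\<Prod>k<CARD('r). A (row k) ((xs @ [j]) ! \<pi> k))"
      using xs ij k0 \<pi> nth by (intro chi_eq[OF _ _ \<pi>(1) T(1)]) auto
    also have "(\<Prod>k<CARD('r). A (row k) ((xs @ [j]) ! \<pi> k)) =
        A i j * (\<Prod>k\<in>{..<CARD('r)} - {k0}. A (row k) ((xs @ [j]) ! \<pi> k))"
      using k0 nth by (subst prod.remove[of _ k0]) auto
    also have "(\<Prod>k\<in>{..<CARD('r)} - {k0}. A (row k) ((xs @ [j]) ! \<pi> k)) = (\<Prod>k\<in>{..<CARD('r)} - {k0}. A (row k) (xs ! \<pi> k))"
      using nth by (intro prod.cong) auto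
    finally show "chi (xs @ [j]) = \<mu> i * A i j"
      using \<mu>[OF k0(3,1)] k0(2) by (simp add: c_def mult_ac)
  next
    fix j assume "j \<in> set xs"
    then obtain m where m: "m < n" "xs ! m = j"
      by (auto simp: in_set_conv_nth n_def)
    obtain i where i: "(i, j) \<in> T"
      using T(2) by blast
    obtain k0 where "k0 < CARD('r)" "row k0 = i"
      by (rule rowE)
    then obtain \<pi> where k0: "k0 < CARD('r)" "row k0 = i" "Q k0 \<pi>"
      using Q_exists by blast
    then have \<pi>: "\<pi> permutes {..<CARD('r)}" "\<pi> k0 = n" "\<And>k. k < CARD('r) \<Longrightarrow> k \<noteq> k0 \<Longrightarrow> (row k, xs ! \<pi> k) \<in> T"
      by (auto simp: Q_def)
    define k1 where "k1 = inv \<pi> m"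
    have k1: "\<pi> k1 = m" "k1 < CARD('r)"
      using \<pi>(1) m(1) permutes_in_image[OF permutes_inv[OF \<pi>(1)], of m]
      by (auto simp: k1_def permutes_inverses card_row)
    then have "k1 \<noteq> k0"
      using \<pi>(2) m(1) by auto
    define \<pi>' where "\<pi>' = \<pi> \<circ> Transposition.transpose k0 k1"
    have \<pi>': "\<pi>' permutes {..<CARD('r)}" "sign \<pi>' = - sign \<pi>"
      unfolding \<pi>'_def using sign_compose_transpose[OF \<pi>(1)] k0(1) k1(2) \<open>k1 \<noteq> k0\<close> by auto
    have \<pi>'_eq: "\<pi>' k1 = n" "\<pi>' k0 = m" "\<And>k. k \<noteq> k0 \<Longrightarrow> k \<noteq> k1 \<Longrightarrow> \<pi>' k = \<pi> k"
      using k1(1) \<pi>(2) by (auto simp: \<pi>'_def Transposition.transpose_def)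
    have "(row k, xs ! \<pi>' k) \<in> T" if "k < CARD('r)" "k \<noteq> k1" for k
      using \<pi>(3) \<pi>'_eq that i k0(2) m(2) by (cases "k = k0") auto
    then have "Q k1 \<pi>'"
      using \<pi>' \<pi>'_eq by (simp add: Q_def)
    define R where "R = (\<Prod>k\<in>{..<CARD('r)} - {k0, k1}. A (row k) (xs ! \<pi> k))"
    have "(\<Prod>k\<in>{..<CARD('r)} - {k0}. A (row k) (xs ! \<pi> k)) = A (row k1) j * R"
      using k1 m(2) \<open>k1 \<noteq> k0\<close> by (subst prod.remove[of _ k1]) (auto simp: R_def insert_commute Diff_insert2[symmetric] intro!: prod.cong)
    then have 1: "\<mu> (row k0) = sign \<pi> * (A (row k1) j * R)"
      using \<mu>[OF k0(3,1)] by (simp add: c_def)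
    have "(\<Prod>k\<in>{..<CARD('r)} - {k1}. A (row k) (xs ! \<pi>' k)) = A (row k0) j * (\<Prod>k\<in>{..<CARD('r)} - {k1} - {k0}. A (row k) (xs ! \<pi>' k))"
      using k0 m(2) \<open>k1 \<noteq> k0\<close> \<pi>'_eq by (subst prod.remove[of _ k0]) auto
    also have "(\<Prod>k\<in>{..<CARD('r)} - {k1} - {k0}. A (row k) (xs ! \<pi>' k)) = R"
      unfolding R_def using \<pi>'_eq by (intro prod.cong) auto
    finally have 2: "\<mu> (row k1) = - sign \<pi> * (A (row k0) j * R)"
      using \<mu>[OF \<open>Q k1 \<pi>'\<close> k1(2)] \<pi>'(2) by (simp add: c_def)
    have "(row k1, j) \<in> T"
      using \<pi>(3)[OF k1(2) \<open>k1 \<noteq> k0\<close>] k1(1) m(2) by simp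
    then show "\<exists>i i'. (i, j) \<in> T \<and> (i', j) \<in> T \<and> \<mu> i * A i j = - (\<mu> i' * A i' j)"
      using i k0(2) 1 2 by (intro exI[of _ "row k0"] exI[of _ "row k1"]) (simp add: mult_ac)
  qed
qed

text \<open>
  If all products had the same weak sign, one could walk forever from \<open>j\<close> in \<open>ys\<close> to a row \<open>i\<close> along
  an edge of the cocircuit tree with \<open>\<mu> i * A i j * C j > 0\<close>, and on from \<open>i\<close> along an edge of the
  circuit tree with \<open>\<mu> i * A i j' * C j' < 0\<close>. A cycle of this walk yields two different flows with the
  same marginals, which is impossible.
\<close>
lemma exchange_not_semidefinite:
  assumes xs: "Suc (length xs) = CARD('r)" "distinct xs" and ys: "length ys = Suc CARD('r)" "distinct ys"
    and s: "\<bar>s\<bar> = 1"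
  shows "\<exists>k\<le>CARD('r). s * exchange_term chi xs ys k < 0"
proof (rule ccontr)
  assume "\<not> ?thesis"
  then have nonneg: "0 \<le> s * exchange_term chi xs ys k" if "k \<le> CARD('r)" for k
    using that by force
  have "CARD('r) \<le> CARD('e)"
    using card_mono[of "UNIV :: 'e set" "set ys"] ys by (simp add: distinct_card)
  from cocircuit_tree[OF xs this] obtain T \<mu> where T: "T \<in> \<G>" "\<And>j. \<exists>i. (i, j) \<in> T"
    and \<mu>: "\<And>i. \<bar>\<mu> i\<bar> = 1"
      "\<And>i j. (i, j) \<in> T \<Longrightarrow> j \<notin> set xs \<Longrightarrow> chi (xs @ [j]) = \<mu> i * A i j"
      "\<And>j. j \<in> set xs \<Longrightarrow> \<exists>i i'. (i, j) \<in> T \<and> (i', j) \<in> T \<and> \<mu> i * A i j = - (\<mu> i' * A i' j)"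
    by metis
  from circuit_tree[OF ys] obtain T' where T': "T' \<in> \<G>"
    "\<And>i. \<exists>k\<le>CARD('r). \<exists>l\<le>CARD('r). (i, ys ! k) \<in> T' \<and> (i, ys ! l) \<in> T' \<and>
       (-1) ^ k * chi (delete_nth k ys) * A i (ys ! k) = - ((-1) ^ l * chi (delete_nth l ys) * A i (ys ! l))"
    by metis
  \<comment> \<open>The minus sign matches the exponent \<open>k + 1\<close> in
    \<open>exchange_term\<close>: for an edge of \<open>T\<close> ending at \<open>ys ! k\<close>
    outside \<open>xs\<close>, the number \<open>w i k\<close> is exactly \<open>s\<close> times the
    exchange term.\<close>
  define C where "C k = - (s * ((-1) ^ k * chi (delete_nth k ys)))" for k
  define w where "w i k = \<mu> i * A i (ys ! k) * C k" for i k
  have "\<bar>C k\<bar> = 1" if "k \<le> CARD('r)" for k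
    using ys that s abs_chi[of "delete_nth k ys"]
    by (simp add: C_def abs_mult power_abs set_take_disj_set_drop_if_distinct)
  then have w_nz: "w i k \<noteq> 0" if "k \<le> CARD('r)" for i k
    using \<mu>(1)[of i] abs_A[of i "ys ! k"] that by (fastforce simp: w_def)
  have "\<exists>i. (i, ys ! k) \<in> T \<and> 0 < w i k" if k: "k \<le> CARD('r)" for k
  proof (cases "ys ! k \<in> set xs")
    \<comment> \<open>Here the exchange term is zero and gives no information, but the two opposite
      values at \<open>ys ! k\<close> supply a positive one.\<close>
    case True
    then obtain i i' where "(i, ys ! k) \<in> T" "(i', ys ! k) \<in> T" "\<mu> i * A i (ys ! k) = - (\<mu> i' * A i' (ys ! k))"
      using \<mu>(3) by blast
    moreover from this(3) have *: "w i k = - w i' k"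
      by (simp add: w_def)
    moreover have "0 < w i k \<or> 0 < w i' k"
      using * w_nz[OF k, of i] by linarith
    ultimately show ?thesis
      by blast
  next
    case False
    obtain i where i: "(i, ys ! k) \<in> T"
      using T(2) by blast
    have "w i k = s * exchange_term chi xs ys k"
      unfolding w_def C_def exchange_term_def \<mu>(2)[OF i False] by simp
    then have "0 < w i k"
      using nonneg[OF k] w_nz[OF k, of i] by linarith
    with i show ?thesis
      by blast
  qed
  then obtain g where g: "\<And>k. k \<le> CARD('r) \<Longrightarrow> (g k, ys ! k) \<in> T \<and> 0 < w (g k) k"
    by metis
  have "\<exists>l\<le>CARD('r). (i, ys ! l) \<in> T' \<and> w i l < 0" for i
  proof -
    obtain k l where kl: "k \<le> CARD('r)" "l \<le> CARD('r)" "(i, ys ! k) \<in> T'" "(i, ys ! l) \<in> T'"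
      "(-1) ^ k * chi (delete_nth k ys) * A i (ys ! k) = - ((-1) ^ l * chi (delete_nth l ys) * A i (ys ! l))"
      using T'(2) by blast
    have w_eq: "w i k = - (s * \<mu> i * ((-1) ^ k * chi (delete_nth k ys) * A i (ys ! k)))" for k
      by (simp add: w_def C_def mult_ac)
    have "w i k = - w i l"
      unfolding w_eq kl(5) by simp
    then have "w i k < 0 \<or> w i l < 0"
      using w_nz[OF kl(1), of i] by linarith
    then show ?thesis
      using kl(1-4) by blast
  qed
  then obtain h where h: "\<And>i. h i \<le> CARD('r) \<and> (i, ys ! h i) \<in> T' \<and> w i (h i) < 0"
    by metis
  \<comment> \<open>Stepping along \<open>g\<close> in \<open>T\<close> and then along
    \<open>h\<close> in \<open>T'\<close> maps positions to positions, so some set of positions is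
    permuted.\<close>
  obtain J where J: "J \<subseteq> {..CARD('r)}" "J \<noteq> {}" "bij_betw (\<lambda>k. h (g k)) J J"
    using exists_invariant_subset[of "{..CARD('r)}" "\<lambda>k. h (g k)"] h by auto
  have "finite J"
    using J(1) finite_subset by blast
  obtain k where "k \<in> J"
    using J(2) by blast
  have "\<exists>l\<in>J. g l = g k \<and> ys ! h (g l) = ys ! k"
  proof (rule exchange_unique[OF T(1) T'(1) \<open>finite J\<close> J(3), where f = "(!) ys"])
    show "(g k, ys ! k) \<in> T" "(g k, ys ! h (g k)) \<in> T'" if "k \<in> J" for k
      using that g h J(1) by auto
  qed fact
  then obtain l where l: "l \<in> J" "g l = g k" "ys ! h (g l) = ys ! k"
    by blast
  \<comment> \<open>The edge from \<open>g k\<close> to \<open>ys ! k\<close> is thus used in both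
    trees, where \<open>w (g k) k\<close> has opposite signs.\<close>
  have "h (g l) = k"
    using l(3) ys h[of "g l"] J(1) \<open>k \<in> J\<close> by (auto simp: nth_eq_iff_index_eq)
  then have "w (g k) k < 0"
    using h[of "g k"] l(2) by simp
  moreover have "0 < w (g k) k"
    using g \<open>k \<in> J\<close> J(1) by auto
  ultimately show False
    by simp
qed

text \<open>If \<open>ys\<close> repeats an entry at \<open>a\<close> and \<open>b\<close>, the
  terms at these two positions are opposite, and every other term vanishes because the shortened
  list still contains the repetition.\<close>

lemma exchange_repeated:
  assumes "length ys = Suc CARD('r)" "\<not> distinct ys"
  shows "(\<exists>k\<le>CARD('r). exchange_term chi xs ys k > 0) \<and> (\<exists>k\<le>CARD('r). exchange_term chi xs ys k < 0) \<or>
    (\<forall>k\<le>CARD('r). exchange_term chi xs ys k = 0)"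
proof -
  obtain a b where ab: "a \<le> CARD('r)" "b \<le> CARD('r)" "a \<noteq> b" "ys ! a = ys ! b"
    using assms by (auto simp: distinct_conv_nth less_Suc_eq_le)
  let ?t = "exchange_term chi xs ys"
  have term_eq: "?t k = - (chi (xs @ [ys ! k]) * ((-1) ^ k * chi (delete_nth k ys)))" for k
    by (simp add: exchange_term_def)
  have opposite: "?t a = - ?t b"
    unfolding term_eq using chi_delete_repeated[OF assms(1) ab(4,1,2,3)] ab(4) by simp
  have zero: "?t k = 0" if "k \<le> CARD('r)" "k \<noteq> a" "k \<noteq> b" for k
  proof -
    have "k < length ys" "a < length ys" "b < length ys"
      using assms(1) ab that by auto
    have "\<not> distinct (delete_nth k ys)"
    proof
      define f where "f x = cycle_to_end k CARD('r) x" for x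
      assume dist: "distinct (delete_nth k ys)"
      have nth: "delete_nth k ys ! f x = ys ! x" if "x \<le> CARD('r)" "x \<noteq> k" for x
        unfolding f_def using nth_delete_nth_cycle_to_end[OF assms(1) \<open>k \<le> CARD('r)\<close> that] .
      have len: "f x < length (delete_nth k ys)" if "x \<le> CARD('r)" "x \<noteq> k" for x
        using that \<open>k < length ys\<close> assms(1) by (auto simp: f_def cycle_to_end_def)
      then have "f a = f b"
        using nth_eq_iff_index_eq[OF dist len[of a] len[of b]] nth[of a] nth[of b] ab that by simp
      then show False
        using ab(3) injD[OF permutes_inj[OF cycle_to_end(1)[OF \<open>k \<le> CARD('r)\<close>]], of a b]
        by (simp add: f_def)
    qed
    then show ?thesis
      unfolding term_eq by (subst chi_not_distinct) auto
  qed
  show ?thesis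
  proof (cases "?t b = 0")
    case True
    then have "?t k = 0" if "k \<le> CARD('r)" for k
      using opposite zero[OF that] by (cases "k = a \<or> k = b") auto
    then show ?thesis
      by simp
  next
    case False
    then consider "?t a > 0" "?t b < 0" | "?t b > 0" "?t a < 0"
      using opposite by linarith
    then show ?thesis
    proof cases
      case 1
      with ab(1,2) show ?thesis
        by (intro disjI1 conjI; intro exI conjI)
    next
      case 2
      with ab(1,2) show ?thesis
        by (intro disjI1 conjI; intro exI conjI)
    qed
  qed
qed

section \<open>The chirotope axioms\<close>

lemma chirotope_chi:
  assumes "CARD('r) \<le> CARD('e)"
  shows "chirotope CARD('r) chi"
  unfolding chirotope_def
proof (intro conjI allI impI)
  fix zs :: "'e list" assume len: "length zs = CARD('r)"
  show "chi zs \<in> {1, -1, 0}"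
  proof (cases "distinct zs")
    case True
    then show ?thesis
      using abs_chi[OF True len] by auto
  qed (simp add: chi_not_distinct)
next
  obtain \<sigma> :: "'e set" where \<sigma>: "card \<sigma> = CARD('r)"
    using assms obtain_subset_with_card_n[of "CARD('r)" "UNIV :: 'e set"] by auto
  then have "\<bar>chi (sorted_list_of_set \<sigma>)\<bar> = 1"
    by (intro abs_chi) simp_all
  then show "\<exists>zs. length zs = CARD('r) \<and> chi zs \<noteq> 0"
    using \<sigma> by (intro exI[of _ "sorted_list_of_set \<sigma>"]) auto
next
  show "alternating CARD('r) chi"
    by (rule alternating_chi)
next
  fix xs ys :: "'e list"
  assume "length xs + 1 = CARD('r) \<and> length ys = CARD('r) + 1"
  then have len: "Suc (length xs) = CARD('r)" "length ys = Suc CARD('r)"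
    by auto
  show "(\<exists>k\<le>CARD('r). exchange_term chi xs ys k > 0) \<and> (\<exists>k\<le>CARD('r). exchange_term chi xs ys k < 0) \<or>
    (\<forall>k\<le>CARD('r). exchange_term chi xs ys k = 0)"
  proof (cases "distinct xs \<and> distinct ys")
    case True
    \<comment> \<open>The choice \<open>s = 1\<close> yields a negative term and
      \<open>s = -1\<close> a positive one.\<close>
    then show ?thesis
      using exchange_not_semidefinite[OF len(1) _ len(2), of 1]
        exchange_not_semidefinite[OF len(1) _ len(2), of "-1"] by auto
  next
    case False
    show ?thesis
    proof (cases "distinct ys")
      case True
      with False have "chi (xs @ [j]) = 0" for j
        by (intro chi_not_distinct) simp
      then show ?thesis
        by (simp add: exchange_term_def)
    next
      case False
      then show ?thesis
        by (rule exchange_repeated[OF len(2)])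
    qed
  qed
qed

end

theorem theorem1:
  fixes M :: "'e::{finite,linorder} set \<Rightarrow> ('r::{finite,linorder} \<times> 'e) set"
    and A :: "'r \<Rightarrow> 'e \<Rightarrow> int"
  assumes "CARD('r) \<le> CARD('e)"
    and "polyhedral_matching_field M"
    and "\<And>i j. A i j \<in> {1, -1}"
  shows "uniform_oriented_matroid_chirotope CARD('r)
           (\<lambda>\<sigma>. matching_sign \<sigma> (M \<sigma>) * (\<Prod>(i, j)\<in>M \<sigma>. A i j))"
proof -
  obtain \<T> where \<T>: "product_triangulation \<T>" "matching_field_of \<T> M"
    using assms(2) unfolding polyhedral_matching_field_def by blast
  interpret tree_family "tree_of ` \<T>"
    by (rule product_triangulation_tree_family[OF \<T>(1)])
  interpret signed_matching_field "tree_of ` \<T>" M A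
  proof
    fix \<sigma> :: "'e set" assume "card \<sigma> = CARD('r)"
    then show "perfect_matching \<sigma> (M \<sigma>)" "\<exists>T\<in>tree_of ` \<T>. M \<sigma> \<subseteq> T"
      using \<T>(2) unfolding matching_field_of_def by auto
  qed (rule assms(3))
  have "A i j \<noteq> 0" for i j
    using assms(3)[of i j] by auto
  then have "matching_sign \<sigma> (M \<sigma>) * (\<Prod>(i, j)\<in>M \<sigma>. A i j) \<noteq> 0" for \<sigma>
    by (auto simp: matching_sign_def sign_on_def)
  with chirotope_chi[OF assms(1)] show ?thesis
    unfolding uniform_oriented_matroid_chirotope_def chi_def by (intro conjI allI impI)
qed

end
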